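(* Let $d_X,d_Y\in\mathbb{N}$, $\mathcal{X}=\mathbb{R}^{d_X}$, $\mathcal{Y}=\mathbb{R}^{d_Y}$. Let $p(x)=n(x;m^f,P^f)$ be a Gaussian prior density on $\mathcal{X}$ and $p(y|x)=n(y;Hx,R)$ a Gaussian likelihood on $\mathcal{Y}$, where $m^f\in\mathbb{R}^{d_X}$, $H\in\mathbb{R}^{d_Y\times d_X}$, and $P^f$, $R$ are symmetric positive definite. Let $k$ be a weight kernel satisfying the kernel conditions (stated in the context), put $w(y)=k(y)R^{1/2}$, and assume the true data generating density $\pi$ on $\mathcal{Y}$ satisfies the regularity conditions (stated in the context) with respect to $p(\cdot|x)$ and $w$. Then the diffusion score matching posterior is globally bias robust, i.e. $$\sup_{x\in\mathcal{X},\,y_0\in\mathcal{Y}}\left.\frac{\mathrm{d}}{\mathrm{d}\varepsilon}p_{\mathrm{DSM}}(x|y_0,\pi_{\varepsilon,y_0})\right|_{\varepsilon=0}<\infty,$$ where $\pi_{\varepsilon,y_0}=(1-\varepsilon)p_y+\varepsilon\delta_{y_0}$ for $\varepsilon\in[0,1]$, $y_0\in\mathcal{Y}$, is the $\varepsilon$-contamination of the observation marginal $p_y$ by the Dirac measure $\delta_{y_0}$.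
   Context: $n(x;m,P)$ denotes the density of the multivariate Gaussian distribution with mean $m$ and covariance $P$; $R^{1/2}$ is the symmetric positive definite square root. Score: $s_{p(\cdot|x)}(y)=\nabla_y\log p(y|x)$, $s_\pi(y)=\nabla_y\log\pi(y)$. The observation marginal is $p_y(y)=\int_{\mathcal X} p(y|x)p(x)\,\mathrm{d}x$, i.e. $n(y;Hm^f,HP^fH^T+R)$. For a probability measure $\nu$ on $\mathcal{Y}$, diffusion score matching is $$\mathrm{DSM}[\nu\|p(\cdot|x)]=\mathbb{E}_{Y\sim\nu}\left[\left\|w^T(Y)s_{p(\cdot|x)}(Y)\right\|_2^2+2\nabla_Y\cdot\left(w(Y)w^T(Y)s_{p(\cdot|x)}(Y)\right)\right],$$ and $p_{\mathrm{DSM}}(x|y_0,\pi_{\varepsilon,y_0})$ denotes the probability density in $x$ proportional to $p(x)\exp\left(-\mathrm{DSM}[\pi_{\varepsilon,y_0}\|p(\cdot|x)]\right)$. Its derivative in $\varepsilon$ at $\varepsilon=0$ is the posterior influence function. Kernel conditions: $k:\mathbb{R}^{d_Y}\to(0,\infty)$ is such that $k^2$ is differentiable and, with all bounds uniform in $y\in\mathbb{R}^{d_Y}$: (i) $k$ takes values in $(0,\bar k]$ for some $\bar k<\infty$; (ii) $|y|\,k(y)$ and $|\nabla_y\cdot[y\,k^2(y)]|$ are bounded; (iii) each partial derivative $\frac{\partial}{\partial y_i}k^2(y)$ and $|\nabla_y\cdot k^2(y)|$ are bounded, where $\nabla_y\cdot k^2=\sum_i\partial_{y_i}k^2$. Regularity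 conditions on $\pi$: for every $x\in\mathcal{X}$, $\int_{\mathcal{Y}}\pi(y)\|s_{p(\cdot|x)}(y)-s_\pi(y)\|^2\,\mathrm{d}y<\infty$, and both $\pi\, ww^Ts_{p(\cdot|x)}$ and $\nabla\cdot(\pi\, ww^Ts_{p(\cdot|x)})$ belong to $L^1(\mathbb{R}^{d_Y})$. *)

theory Defs
  imports "HOL-Probability.Probability"
begin

definition sym_pos_def :: "real^'n^'n \<Rightarrow> bool" where
  "sym_pos_def A \<longleftrightarrow> transpose A = A \<and> (\<forall>x. x \<noteq> 0 \<longrightarrow> x \<bullet> (A *v x) > 0)"

definition matrix_sqrt :: "real^'n^'n \<Rightarrow> real^'n^'n" where
  "matrix_sqrt A = (THE S. sym_pos_def S \<and> S ** S = A)"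

definition gaussian_density :: "real^'n \<Rightarrow> real^'n^'n \<Rightarrow> real^'n \<Rightarrow> real" where
  "gaussian_density m P x =
     exp (- ((x - m) \<bullet> (matrix_inv P *v (x - m))) / 2) / sqrt ((2 * pi) ^ CARD('n) * det P)"

definition partial_deriv :: "'n \<Rightarrow> (real^'n \<Rightarrow> real) \<Rightarrow> real^'n \<Rightarrow> real" where
  "partial_deriv i f y = deriv (\<lambda>t. f (y + t *\<^sub>R axis i 1)) 0"

definition grad :: "(real^'n \<Rightarrow> real) \<Rightarrow> real^'n \<Rightarrow> real^'n" where
  "grad f y = (\<chi> i. partial_deriv i f y)"

definition divergence :: "(real^'n \<Rightarrow> real^'n) \<Rightarrow> real^'n \<Rightarrow> real" where
  "divergence F y = (\<Sum>i\<in>UNIV. partial_deriv i (\<lambda>z. F z $ i) y)"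

definition score :: "(real^'n \<Rightarrow> real) \<Rightarrow> real^'n \<Rightarrow> real^'n" where
  "score q y = grad (\<lambda>z. ln (q z)) y"

definition DSM ::
  "(real^'n \<Rightarrow> real^'n^'n) \<Rightarrow> (real^'n) measure \<Rightarrow> (real^'n \<Rightarrow> real) \<Rightarrow> real" where
  "DSM w \<nu> q =
     (\<integral>y. (norm (transpose (w y) *v score q y))\<^sup>2
          + 2 * divergence (\<lambda>z. (w z ** transpose (w z)) *v score q z) y \<partial>\<nu>)"

definition DSM_posterior ::
  "(real^'m \<Rightarrow> real) \<Rightarrow> (real^'m \<Rightarrow> real^'n \<Rightarrow> real) \<Rightarrow> (real^'n \<Rightarrow> real^'n^'n)
    \<Rightarrow> (real^'n) measure \<Rightarrow> real^'m \<Rightarrow> real" where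
  "DSM_posterior prior lik w \<nu> x =
     prior x * exp (- DSM w \<nu> (lik x)) / (\<integral>x'. prior x' * exp (- DSM w \<nu> (lik x')) \<partial>lborel)"

definition obs_marginal ::
  "(real^'m \<Rightarrow> real) \<Rightarrow> (real^'m \<Rightarrow> real^'n \<Rightarrow> real) \<Rightarrow> real^'n \<Rightarrow> real" where
  "obs_marginal prior lik y = (\<integral>x. lik x y * prior x \<partial>lborel)"

definition contamination :: "(real^'n \<Rightarrow> real) \<Rightarrow> real \<Rightarrow> real^'n \<Rightarrow> (real^'n) measure" where
  "contamination q \<epsilon> y0 =
     measure_of UNIV (sets borel)
       (\<lambda>A. ennreal (1 - \<epsilon>) * emeasure (density lborel (\<lambda>y. ennreal (q y))) A
          + ennreal \<epsilon> * emeasure (return borel y0) A)"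

(* measure_of silently yields the zero measure unless the given set function is a measure. *)
lemma emeasure_contamination:
  assumes "A \<in> sets borel"
  shows "emeasure (contamination q \<epsilon> y0) A =
     ennreal (1 - \<epsilon>) * emeasure (density lborel (\<lambda>y. ennreal (q y))) A
     + ennreal \<epsilon> * emeasure (return borel y0) A"
proof (rule emeasure_measure_of[OF contamination_def])
  let ?M = "density lborel (\<lambda>y. ennreal (q y))" and ?D = "return borel y0"
  show "countably_additive (sets (contamination q \<epsilon> y0))
     (\<lambda>A. ennreal (1 - \<epsilon>) * emeasure ?M A + ennreal \<epsilon> * emeasure ?D A)"
  proof (rule countably_additiveI)
    fix A :: "nat \<Rightarrow> (real^'a) set"
    assume "range A \<subseteq> sets (contamination q \<epsilon> y0)" and dj: "disjoint_family A"
    then have A: "range A \<subseteq> sets borel"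
      by (simp add: contamination_def sets.sigma_sets_eq[of borel, simplified])
    have "(\<Sum>i. emeasure ?M (A i)) = emeasure ?M (\<Union>i. A i)"
      using A dj by (intro suminf_emeasure) auto
    moreover have "(\<Sum>i. emeasure ?D (A i)) = emeasure ?D (\<Union>i. A i)"
      using A dj by (intro suminf_emeasure) auto
    ultimately show "(\<Sum>i. ennreal (1 - \<epsilon>) * emeasure ?M (A i) + ennreal \<epsilon> * emeasure ?D (A i))
       = ennreal (1 - \<epsilon>) * emeasure ?M (\<Union>i. A i) + ennreal \<epsilon> * emeasure ?D (\<Union>i. A i)"
      by (simp flip: suminf_add)
  qed
qed (use assms in \<open>auto simp: positive_def contamination_def sets.sigma_sets_eq[of borel, simplified]\<close>)

definition kernel_conditions :: "(real^'n \<Rightarrow> real) \<Rightarrow> bool" where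
  "kernel_conditions k \<longleftrightarrow>
     (\<forall>y. (\<lambda>z. (k z)\<^sup>2) differentiable (at y)) \<and>
     (\<exists>kbar. \<forall>y. 0 < k y \<and> k y \<le> kbar) \<and>
     bounded (range (\<lambda>y. norm y * k y)) \<and>
     bounded (range (divergence (\<lambda>y. (k y)\<^sup>2 *\<^sub>R y))) \<and>
     (\<forall>i. bounded (range (partial_deriv i (\<lambda>y. (k y)\<^sup>2)))) \<and>
     bounded (range (\<lambda>y. \<Sum>i\<in>UNIV. partial_deriv i (\<lambda>z. (k z)\<^sup>2) y))"

definition prob_density :: "(real^'n \<Rightarrow> real) \<Rightarrow> bool" where
  "prob_density q \<longleftrightarrow>
     q \<in> borel_measurable borel \<and> (\<forall>y. 0 \<le> q y) \<and> prob_space (density lborel (\<lambda>y. ennreal (q y)))"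

definition regularity_conditions ::
  "(real^'m \<Rightarrow> real^'n \<Rightarrow> real) \<Rightarrow> (real^'n \<Rightarrow> real^'n^'n) \<Rightarrow> (real^'n \<Rightarrow> real) \<Rightarrow> bool" where
  "regularity_conditions lik w q \<longleftrightarrow>
     (\<forall>x. (\<integral>\<^sup>+y. ennreal (q y * (norm (score (lik x) y - score q y))\<^sup>2) \<partial>lborel) < \<infinity> \<and>
          integrable lborel (\<lambda>y. q y *\<^sub>R ((w y ** transpose (w y)) *v score (lik x) y)) \<and>
          integrable lborel (divergence (\<lambda>y. q y *\<^sub>R ((w y ** transpose (w y)) *v score (lik x) y))))"

end

theory Submission imports Defs begin

text \<open>
  Since \<open>w w\<^sup>T = k\<^sup>2 R\<close> and the score of \<open>p(\<cdot>|x)\<close> is \<open>- R\<^sup>-\<^sup>1 (y - H x)\<close>, the flux \<open>w w\<^sup>T s\<close>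
  is \<open>- k\<^sup>2 (y - H x)\<close>: the matrix \<open>R\<close> cancels, and the DSM integrand is
  \<open>J(x, y) = k\<^sup>2 (y - H x)\<^sup>T R\<^sup>-\<^sup>1 (y - H x) - 2 \<nabla>\<cdot>(k\<^sup>2 y) + 2 \<nabla>k\<^sup>2 \<cdot> H x\<close>.
  The kernel conditions bound it uniformly in \<open>y\<close>, by \<open>C (1 + |x|\<^sup>2)\<close> in absolute value and by
  \<open>- C (1 + |x|)\<close> from below. Along the contamination the DSM loss is affine in \<open>\<epsilon>\<close>, namely
  \<open>(1 - \<epsilon>) a(x) + \<epsilon> J(x, y\<^sub>0)\<close> with \<open>a\<close> the mean of \<open>J(x, \<cdot>)\<close> under the marginal, so the numerator,
  the normalising constant and their derivatives in \<open>\<epsilon>\<close> are all dominated, uniformly in \<open>y\<^sub>0\<close>, by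
  multiples of \<open>p(x) (1 + |x|\<^sup>2) exp (C (1 + |x|))\<close>, which is bounded and integrable because the
  Gaussian prior decays faster than any \<open>exp (- C |x|)\<close>.
\<close>

subsection \<open>Spectral theorem and the positive definite square root\<close>

text \<open>Rayleigh quotient argument: a maximiser \<open>v\<close> of
  \<open>x \<bullet> f x\<close> on the compact unit sphere of \<open>V\<close> is an eigenvector.
  The residual \<open>h = f v - l v\<close> stays in \<open>V\<close> and is orthogonal to
  \<open>v\<close>; if it were nonzero, a small move from \<open>v\<close> along \<open>h\<close>
  would raise the quotient above its maximum \<open>l\<close>.\<close>

lemma self_adjoint_eigenvector:
  fixes f :: "'a::euclidean_space \<Rightarrow> 'a"
  assumes lin: "linear f" and sa: "\<And>x y. f x \<bullet> y = x \<bullet> f y"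
    and V: "subspace V" "f ` V \<subseteq> V" "V \<noteq> {0}"
  obtains v l where "v \<in> V" "norm v = 1" "f v = l *\<^sub>R v"
proof -
  let ?K = "V \<inter> sphere 0 1"
  have "compact ?K"
    using closed_subspace[OF V(1)] by (intro closed_Int_compact) auto
  moreover have "?K \<noteq> {}"
  proof -
    obtain x where "x \<in> V" "x \<noteq> 0"
      using V(1,3) subspace_0 by blast
    then have "x /\<^sub>R norm x \<in> ?K"
      using V(1) by (auto simp: subspace_scale)
    then show ?thesis by blast
  qed
  moreover have "continuous_on ?K (\<lambda>x. x \<bullet> f x)"
    by (intro continuous_intros linear_continuous_on linear_linear[THEN iffD2] lin)
  ultimately obtain v where v: "v \<in> ?K" and vmax: "\<And>x. x \<in> ?K \<Longrightarrow> x \<bullet> f x \<le> v \<bullet> f v"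
    using continuous_attains_sup[of ?K "\<lambda>x. x \<bullet> f x"] by blast
  define l where "l = v \<bullet> f v"
  have q: "x \<bullet> f x \<le> l * (x \<bullet> x)" if "x \<in> V" for x
  proof (cases "x = 0")
    case False
    have "x /\<^sub>R norm x \<in> ?K"
      using V(1) that False by (auto simp: subspace_scale)
    from vmax[OF this] have "(x \<bullet> f x) / (norm x)\<^sup>2 \<le> l"
      by (simp add: l_def linear_cmul[OF lin] power2_eq_square divide_inverse mult_ac)
    then show ?thesis
      using False by (simp add: field_simps power2_norm_eq_inner)
  qed (simp add: linear_0[OF lin])
  define h where "h = f v - l *\<^sub>R v"
  have hV: "h \<in> V"
    unfolding h_def using v V by (auto intro!: subspace_diff subspace_scale)
  have vv: "v \<bullet> v = 1"
    using v by (simp add: norm_eq_1)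
  have vh: "v \<bullet> h = 0"
    by (simp add: h_def inner_diff_right vv l_def)
  have hfv: "h \<bullet> f v = h \<bullet> h"
    using vh by (simp add: h_def inner_diff_right inner_diff_left inner_commute)
  have "h = 0"
  proof (rule ccontr)
    assume "h \<noteq> 0"
    define N where "N = h \<bullet> h"
    define c where "c = h \<bullet> f h - l * N"
    have N: "N > 0" using \<open>h \<noteq> 0\<close> by (simp add: N_def)
    \<comment> \<open>This is \<open>q\<close> at \<open>v + t h\<close>. The terms of order zero
      cancel, and the first-order coefficient is \<open>2 N\<close> because
      \<open>h \<bullet> f v = h \<bullet> h\<close>.\<close>
    have ineq: "2 * t * N + t\<^sup>2 * c \<le> 0" for t
    proof -
      have "v + t *\<^sub>R h \<in> V"
        using v V hV by (auto intro!: subspace_add subspace_scale)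
      from q[OF this] have "l + 2 * t * (h \<bullet> f v) + t\<^sup>2 * (h \<bullet> f h) \<le> l * (1 + t\<^sup>2 * N)"
        using sa[of v h] vh
        by (simp add: linear_add[OF lin] linear_cmul[OF lin] inner_add_left inner_add_right
            vv N_def l_def inner_commute power2_eq_square algebra_simps)
      then show ?thesis
        by (simp add: hfv c_def N_def algebra_simps)
    qed
    \<comment> \<open>Small enough that \<open>t * \<bar>c\<bar> \<le> N\<close>, so the quadratic
      term cannot offset \<open>2 N\<close>; the summand 1 avoids division by zero.\<close>
    define t where "t = N / (\<bar>c\<bar> + 1)"
    have t: "t > 0" using N by (simp add: t_def add_nonneg_pos)
    have "t * (2 * N + t * c) \<le> 0"
      using ineq[of t] by (simp add: algebra_simps power2_eq_square)
    then have "2 * N + t * c \<le> 0"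
      using t by (simp add: mult_le_0_iff)
    moreover have "t * \<bar>c\<bar> \<le> N"
      using N by (simp add: t_def field_simps)
    then have "- N \<le> t * c"
      using t by (smt (verit) mult_minus_right abs_ge_self abs_minus_le_zero mult_left_mono)
    ultimately show False using N by linarith
  qed
  then have "f v = l *\<^sub>R v" by (simp add: h_def)
  then show ?thesis using that v by auto
qed

text \<open>Induction on the dimension: split off a unit eigenvector \<open>v\<close> of
  \<open>V\<close>. Self-adjointness keeps the orthogonal complement of \<open>v\<close> in
  \<open>V\<close> invariant, and that complement has smaller dimension.\<close>

lemma self_adjoint_orthonormal_eigenbasis:
  fixes f :: "'a::euclidean_space \<Rightarrow> 'a"
  assumes lin: "linear f" and sa: "\<And>x y. f x \<bullet> y = x \<bullet> f y"
    and "subspace V" "f ` V \<subseteq> V"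
  shows "\<exists>B l. finite B \<and> pairwise orthogonal B \<and> (\<forall>b\<in>B. norm b = 1 \<and> f b = l b *\<^sub>R b) \<and> span B = V"
  using assms(3,4)
proof (induction "dim V" arbitrary: V rule: less_induct)
  case less
  show ?case
  proof (cases "V = {0}")
    case True
    then show ?thesis by (intro exI[of _ "{}"]) auto
  next
    case False
    then obtain v m where v: "v \<in> V" "norm v = 1" "f v = m *\<^sub>R v"
      using self_adjoint_eigenvector[OF lin sa less.prems] by metis
    let ?W = "V \<inter> {x. v \<bullet> x = 0}"
    have W: "subspace ?W"
      using less.prems(1) by (intro subspace_inter subspace_hyperplane)
    have fW: "f ` ?W \<subseteq> ?W"
      using less.prems(2) sa[of v] v(3) by (auto simp flip: sa)
    have "v \<notin> ?W"
      using v(2) by (auto simp: norm_eq_1)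
    then have "?W \<subset> V" using v(1) by blast
    then have "dim ?W < dim V"
      using W less.prems(1) by (metis dim_psubset span_eq_iff)
    from less.hyps[OF this W fW] obtain B l
      where B: "finite B" "pairwise orthogonal B" "\<forall>b\<in>B. norm b = 1 \<and> f b = l b *\<^sub>R b" "span B = ?W"
      by auto
    have vB: "v \<notin> B"
      using \<open>v \<notin> ?W\<close> B(4) span_superset by blast
    have orth: "v \<bullet> b = 0" if "b \<in> B" for b
      using that B(4) span_superset by blast
    have "span (insert v B) = V"
    proof
      show "span (insert v B) \<subseteq> V"
        using v(1) B(4) span_superset[of B] less.prems(1) by (intro span_minimal) auto
      show "V \<subseteq> span (insert v B)"
      proof
        fix x assume x: "x \<in> V"
        have "x - (v \<bullet> x) *\<^sub>R v \<in> ?W"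
          using x v less.prems(1)
          by (auto intro!: subspace_diff subspace_scale simp: inner_diff_right norm_eq_1)
        then have "x - (v \<bullet> x) *\<^sub>R v \<in> span B" using B(4) by simp
        then show "x \<in> span (insert v B)"
          unfolding span_insert by blast
      qed
    qed
    moreover have "pairwise orthogonal (insert v B)"
      using B(2) orth by (auto simp: pairwise_insert orthogonal_def inner_commute)
    moreover have "\<forall>b\<in>insert v B. norm b = 1 \<and> f b = (l(v := m)) b *\<^sub>R b"
      using B(3) v vB by auto
    ultimately show ?thesis
      using B(1) by (intro exI[of _ "insert v B"] exI[of _ "l(v := m)"]) auto
  qed
qed

section \<open>Symmetric matrices and their square roots\<close>

lemma symmetric_matrix_inner:
  fixes A :: "real^'n^'n"
  assumes "transpose A = A"
  shows "(A *v x) \<bullet> y = x \<bullet> (A *v y)"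
  by (metis assms dot_lmul_matrix transpose_matrix_vector)

lemma symmetric_matrixI:
  fixes A :: "real^'n^'n"
  assumes "\<And>x y. (A *v x) \<bullet> y = x \<bullet> (A *v y)"
  shows "transpose A = A"
proof -
  have "transpose A *v x = A *v x" for x
  proof (rule vector_eq_rdot[THEN iffD1], rule allI)
    fix z
    show "(transpose A *v x) \<bullet> z = (A *v x) \<bullet> z"
      by (simp add: assms dot_lmul_matrix transpose_matrix_vector)
  qed
  then show ?thesis by (simp add: matrix_eq)
qed

lemma symmetric_matrix_orthonormal_eigenbasis:
  fixes A :: "real^'n^'n"
  assumes "transpose A = A"
  obtains B l where "finite B" "pairwise orthogonal B" "\<And>b. b \<in> B \<Longrightarrow> norm b = 1"
    "\<And>b. b \<in> B \<Longrightarrow> A *v b = l b *\<^sub>R b" "\<And>x. (\<Sum>b\<in>B. (x \<bullet> b) *\<^sub>R b) = x"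
proof -
  obtain B l where B: "finite B" "pairwise orthogonal B"
      "\<forall>b\<in>B. norm b = 1 \<and> A *v b = l b *\<^sub>R b" "span B = UNIV"
    using self_adjoint_orthonormal_eigenbasis[OF _ symmetric_matrix_inner[OF assms], of UNIV]
    by auto
  have "(\<Sum>b\<in>B. (x \<bullet> b) *\<^sub>R b) = x" for x
    by (rule orthonormal_basis_expand) (use B in auto)
  with B that show ?thesis by blast
qed

text \<open>In an orthonormal eigenbasis of \<open>A\<close> all eigenvalues are positive;
  \<open>S\<close> is the map that scales each basis vector by the square root of its
  eigenvalue.\<close>

lemma sym_pos_def_sqrt_exists:
  fixes A :: "real^'n^'n"
  assumes "sym_pos_def A"
  shows "\<exists>S. sym_pos_def S \<and> S ** S = A"
proof -
  have sym: "transpose A = A" and pos: "\<And>x. x \<noteq> 0 \<Longrightarrow> x \<bullet> (A *v x) > 0"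
    using assms by (auto simp: sym_pos_def_def)
  obtain B l where B: "finite B" "pairwise orthogonal B" "\<And>b. b \<in> B \<Longrightarrow> norm b = 1"
    and eig: "\<And>b. b \<in> B \<Longrightarrow> A *v b = l b *\<^sub>R b"
    and expand: "\<And>x. (\<Sum>b\<in>B. (x \<bullet> b) *\<^sub>R b) = x"
    using symmetric_matrix_orthonormal_eigenbasis[OF sym] by blast
  have lpos: "l b > 0" if "b \<in> B" for b
    using pos[of b] B(3)[OF that] eig[OF that] by (cases "b = 0") (auto simp: norm_eq_1)
  define s where "s = (\<lambda>x. \<Sum>b\<in>B. (sqrt (l b) * (x \<bullet> b)) *\<^sub>R b)"
  have lins: "linear s"
    unfolding s_def
    by (intro linearI)
      (auto simp: inner_add_left algebra_simps sum.distrib scaleR_sum_right)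
  define S where "S = matrix s"
  have S: "S *v x = s x" for x
    by (simp add: S_def matrix_works lins linear_matrix_vector_mul_eq)
  have inner_s: "y \<bullet> s x = (\<Sum>b\<in>B. sqrt (l b) * (x \<bullet> b) * (y \<bullet> b))" for x y
    by (simp add: s_def inner_sum_right)
  have sB: "s b = sqrt (l b) *\<^sub>R b" if "b \<in> B" for b
  proof -
    have "s b = (\<Sum>c\<in>B. if c = b then sqrt (l b) *\<^sub>R b else 0)"
      unfolding s_def
    proof (rule sum.cong)
      fix c assume "c \<in> B"
      then show "(sqrt (l c) * (b \<bullet> c)) *\<^sub>R c = (if c = b then sqrt (l b) *\<^sub>R b else 0)"
        using B(2,3) that by (auto simp: pairwise_def orthogonal_def norm_eq_1)
    qed simp
    also have "\<dots> = sqrt (l b) *\<^sub>R b"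
      using that B(1) by simp
    finally show ?thesis .
  qed
  have "sym_pos_def S"
    unfolding sym_pos_def_def
  proof (intro conjI allI impI)
    show "transpose S = S"
      by (intro symmetric_matrixI)
        (simp add: S inner_s inner_commute[of "s _"] mult_ac)
    fix x :: "real^'n" assume x: "x \<noteq> 0"
    have "\<exists>b\<in>B. x \<bullet> b \<noteq> 0"
      using expand[of x] x by (metis (no_types, lifting) scale_zero_left sum.neutral)
    then obtain b where b: "b \<in> B" "x \<bullet> b \<noteq> 0" by blast
    have "0 < (\<Sum>b\<in>B. sqrt (l b) * (x \<bullet> b)\<^sup>2)"
      by (rule sum_pos2[OF B(1) b(1)]) (use b lpos in \<open>auto simp: less_imp_le\<close>)
    then show "x \<bullet> (S *v x) > 0"
      by (simp add: S inner_s power2_eq_square mult_ac)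
  qed
  moreover have "S ** S = A"
  proof -
    have "(S ** S) *v x = A *v x" for x
    proof -
      have "(S ** S) *v x = s (s (\<Sum>b\<in>B. (x \<bullet> b) *\<^sub>R b))"
        by (simp add: S expand flip: matrix_vector_mul_assoc)
      also have "\<dots> = (\<Sum>b\<in>B. (x \<bullet> b) *\<^sub>R s (s b))"
        by (simp add: linear_sum[OF lins] linear_cmul[OF lins])
      also have "\<dots> = (\<Sum>b\<in>B. (x \<bullet> b) *\<^sub>R (A *v b))"
        using lpos by (intro sum.cong) (auto simp: sB linear_cmul[OF lins] eig less_imp_le)
      also have "\<dots> = A *v (\<Sum>b\<in>B. (x \<bullet> b) *\<^sub>R b)"
        by (simp add: linear_sum[OF matrix_vector_mul_linear] linear_cmul[OF matrix_vector_mul_linear])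
      also have "\<dots> = A *v x"
        by (simp add: expand)
      finally show ?thesis .
    qed
    then show ?thesis by (simp add: matrix_eq)
  qed
  ultimately show ?thesis by blast
qed

text \<open>An eigenvector \<open>b\<close> of \<open>S - T\<close> with eigenvalue \<open>l\<close> satisfies
  \<open>0 = |S b|\<^sup>2 - |T b|\<^sup>2 = l (b \<bullet> S b + b \<bullet> T b)\<close>, which forces \<open>l = 0\<close>.\<close>

lemma sym_pos_def_sqrt_unique:
  fixes S T :: "real^'n^'n"
  assumes S: "sym_pos_def S" and T: "sym_pos_def T" and eq: "S ** S = T ** T"
  shows "S = T"
proof -
  have symS: "transpose S = S" and symT: "transpose T = T"
    using S T by (auto simp: sym_pos_def_def)
  have symD: "transpose (S - T) = S - T"
    by (rule symmetric_matrixI)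
      (simp add: matrix_vector_mult_diff_rdistrib inner_diff_left inner_diff_right
        symmetric_matrix_inner[OF symS] symmetric_matrix_inner[OF symT])
  obtain B l where B: "finite B" "pairwise orthogonal B" "\<And>b. b \<in> B \<Longrightarrow> norm b = 1"
    and eig: "\<And>b. b \<in> B \<Longrightarrow> (S - T) *v b = l b *\<^sub>R b"
    and expand: "\<And>x. (\<Sum>b\<in>B. (x \<bullet> b) *\<^sub>R b) = x"
    using symmetric_matrix_orthonormal_eigenbasis[OF symD] by blast
  have eq': "S *v (S *v x) = T *v (T *v x)" for x
    by (simp add: eq matrix_vector_mul_assoc)
  have l0: "l b = 0" if b: "b \<in> B" for b
  proof -
    have e: "S *v b = T *v b + l b *\<^sub>R b"
      using eig[OF b] by (simp add: matrix_vector_mult_diff_rdistrib algebra_simps)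
    have "(S *v b) \<bullet> (S *v b) = (T *v b) \<bullet> (T *v b)"
      by (simp add: symmetric_matrix_inner[OF symS] symmetric_matrix_inner[OF symT] eq')
    moreover have "(S *v b) \<bullet> (S *v b) - (T *v b) \<bullet> (T *v b)
        = (S *v b - T *v b) \<bullet> (S *v b + T *v b)"
      by (simp add: inner_diff_left inner_add_right inner_commute[of "T *v b" "S *v b"])
    moreover have "S *v b - T *v b = l b *\<^sub>R b"
      by (simp add: e)
    ultimately have "l b * (b \<bullet> (S *v b) + b \<bullet> (T *v b)) = 0"
      by (simp add: inner_add_right distrib_left del: mult_eq_0_iff)
    moreover have "b \<noteq> 0" using B(3)[OF b] by auto
    then have "b \<bullet> (S *v b) > 0" "b \<bullet> (T *v b) > 0"
      using S T by (auto simp: sym_pos_def_def)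
    ultimately show ?thesis by auto
  qed
  have "(S - T) *v x = 0" for x
  proof -
    have "(S - T) *v x = (S - T) *v (\<Sum>b\<in>B. (x \<bullet> b) *\<^sub>R b)"
      by (simp add: expand)
    also have "\<dots> = (\<Sum>b\<in>B. (x \<bullet> b) *\<^sub>R ((S - T) *v b))"
      by (simp add: linear_sum[OF matrix_vector_mul_linear] linear_cmul[OF matrix_vector_mul_linear])
    also have "\<dots> = 0"
      by (simp add: eig l0)
    finally show ?thesis .
  qed
  then show ?thesis
    by (simp add: matrix_eq matrix_vector_mult_diff_rdistrib)
qed

text \<open>Existence and uniqueness together let the definite description in
  \<open>matrix_sqrt\<close> denote, so its defining properties become available.\<close>

lemma matrix_sqrt:
  fixes A :: "real^'n^'n"
  assumes "sym_pos_def A"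
  shows "sym_pos_def (matrix_sqrt A)" "matrix_sqrt A ** matrix_sqrt A = A"
proof -
  have "\<exists>!S. sym_pos_def S \<and> S ** S = A"
    using sym_pos_def_sqrt_exists[OF assms] sym_pos_def_sqrt_unique by metis
  from theI'[OF this] show "sym_pos_def (matrix_sqrt A)" "matrix_sqrt A ** matrix_sqrt A = A"
    by (auto simp: matrix_sqrt_def)
qed

section \<open>Inverse, determinant and coercivity of positive definite matrices\<close>

lemma sym_pos_def_invertible:
  fixes A :: "real^'n^'n"
  assumes "sym_pos_def A"
  shows "invertible A"
proof -
  have "A *v x = 0 \<Longrightarrow> x = 0" for x
    using assms by (metis sym_pos_def_def inner_zero_right less_irrefl)
  then show ?thesis
    by (meson invertible_left_inverse matrix_left_invertible_ker)
qed

text \<open>The determinant is the square of \<open>det (matrix_sqrt A)\<close>, and invertibility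
  excludes zero.\<close>

lemma sym_pos_def_det_pos:
  fixes A :: "real^'n^'n"
  assumes "sym_pos_def A"
  shows "det A > 0"
proof -
  have "det A = det (matrix_sqrt A) * det (matrix_sqrt A)"
    by (metis assms det_mul matrix_sqrt(2))
  moreover have "det A \<noteq> 0"
    using sym_pos_def_invertible[OF assms] invertible_det_nz by blast
  ultimately show ?thesis
    by (metis not_real_square_gt_zero mult_eq_0_iff)
qed

lemma sym_pos_def_inverse_mult:
  fixes A :: "real^'n^'n"
  assumes "sym_pos_def A"
  shows "A *v (matrix_inv A *v x) = x"
proof -
  have "A ** matrix_inv A = mat 1"
    using someI_ex[OF sym_pos_def_invertible[OF assms, unfolded invertible_def]]
    by (simp add: matrix_inv_def)
  then show ?thesis
    by (simp add: matrix_vector_mul_assoc)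
qed

lemma sym_pos_def_matrix_inv:
  fixes A :: "real^'n^'n"
  assumes A: "sym_pos_def A"
  shows "sym_pos_def (matrix_inv A)"
proof -
  have sym: "transpose A = A" and pos: "\<And>x. x \<noteq> 0 \<Longrightarrow> x \<bullet> (A *v x) > 0"
    using A by (auto simp: sym_pos_def_def)
  note inv = sym_pos_def_inverse_mult[OF A]
  show ?thesis
    unfolding sym_pos_def_def
  proof (intro conjI allI impI)
    show "transpose (matrix_inv A) = matrix_inv A"
      by (rule symmetric_matrixI) (metis inv sym symmetric_matrix_inner)
    fix x :: "real^'n" assume "x \<noteq> 0"
    then have "matrix_inv A *v x \<noteq> 0"
      using inv[of x] by auto
    from pos[OF this] show "x \<bullet> (matrix_inv A *v x) > 0"
      by (simp add: inv inner_commute)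
  qed
qed

text \<open>\<open>c\<close> is the minimum of the quadratic form on the unit sphere: compactness
  makes it attained and hence positive, and homogeneity carries the bound to all vectors.\<close>

lemma sym_pos_def_coercive:
  fixes A :: "real^'n^'n"
  assumes "sym_pos_def A"
  obtains c where "c > 0" "\<And>x. c * (norm x)\<^sup>2 \<le> x \<bullet> (A *v x)"
proof -
  let ?K = "sphere (0::real^'n) 1"
  have "axis undefined 1 \<in> ?K" by simp
  then have "?K \<noteq> {}" by blast
  moreover have "continuous_on ?K (\<lambda>x. x \<bullet> (A *v x))"
    by (intro continuous_intros)
  ultimately obtain v where v: "v \<in> ?K" and vmin: "\<And>x. x \<in> ?K \<Longrightarrow> v \<bullet> (A *v v) \<le> x \<bullet> (A *v x)"
    using continuous_attains_inf[OF compact_sphere, of 0 1 "\<lambda>x. x \<bullet> (A *v x)"] by blast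
  have "v \<bullet> (A *v v) * (norm x)\<^sup>2 \<le> x \<bullet> (A *v x)" for x
  proof (cases "x = 0")
    case False
    then have "x /\<^sub>R norm x \<in> ?K" by simp
    from vmin[OF this] have "v \<bullet> (A *v v) \<le> (x \<bullet> (A *v x)) / (norm x)\<^sup>2"
      by (simp add: linear_cmul[OF matrix_vector_mul_linear] power2_eq_square divide_inverse mult_ac)
    then show ?thesis
      using False by (simp add: field_simps)
  qed simp
  moreover have "v \<bullet> (A *v v) > 0"
    using v assms by (cases "v = 0") (auto simp: sym_pos_def_def)
  ultimately show ?thesis using that by blast
qed

subsection \<open>Gaussian densities, scores and the DSM integrand\<close>

text \<open>\<open>partial_deriv\<close> is built on \<open>deriv\<close>, which says nothing where
  no derivative exists; differentiability turns it into a genuine derivative.\<close>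

lemma differentiable_imp_partial_deriv:
  fixes f :: "real^'n \<Rightarrow> real"
  assumes "f differentiable (at y)"
  shows "((\<lambda>t. f (y + t *\<^sub>R axis i 1)) has_real_derivative partial_deriv i f y) (at 0)"
proof -
  have "(f \<circ> (\<lambda>t. y + t *\<^sub>R axis i 1)) differentiable (at (0::real))"
    by (intro differentiable_chain_at) (use assms in \<open>auto intro!: derivative_intros\<close>)
  then show ?thesis
    by (simp add: partial_deriv_def DERIV_deriv_iff_real_differentiable comp_def)
qed

lemma partial_deriv_eqI:
  assumes "((\<lambda>t. f (y + t *\<^sub>R axis i 1)) has_real_derivative d) (at 0)"
  shows "partial_deriv i f y = d"
  using assms by (simp add: partial_deriv_def DERIV_imp_deriv)

text \<open>The derivative may be discontinuous, but it is the pointwise limit of difference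
  quotients with increments \<open>1 / (n + 1)\<close>, each of which is continuous.\<close>

lemma borel_measurable_partial_deriv:
  fixes f :: "real^'n \<Rightarrow> real"
  assumes "\<And>y. f differentiable (at y)"
  shows "partial_deriv i f \<in> borel_measurable borel"
proof (rule borel_measurable_LIMSEQ_real)
  have cont: "continuous_on UNIV f"
    using assms by (simp add: differentiable_imp_continuous_on differentiable_on_def)
  let ?q = "\<lambda>n y. (f (y + inverse (real (Suc n)) *\<^sub>R axis i 1) - f y) / inverse (real (Suc n))"
  show "(\<lambda>n. ?q n y) \<longlonglongrightarrow> partial_deriv i f y" for y
  proof -
    have "((\<lambda>t. (f (y + t *\<^sub>R axis i 1) - f y) / t) \<longlongrightarrow> partial_deriv i f y) (at 0)"
      using differentiable_imp_partial_deriv[OF assms, of y i] by (simp add: DERIV_def)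
    moreover have "filterlim (\<lambda>n. inverse (real (Suc n))) (at 0) sequentially"
      using LIMSEQ_inverse_real_of_nat by (auto simp: filterlim_at)
    ultimately show ?thesis
      by (rule filterlim_compose)
  qed
  show "?q n \<in> borel_measurable borel" for n
    by (intro borel_measurable_continuous_onI continuous_intros
        continuous_on_compose2[OF cont]) auto
qed

text \<open>The integrand is a product over coordinates, so Tonelli reduces the claim to one
  dimension, where the factor is a multiple of the normal density with variance
  \<open>1 / (2 * c)\<close>.\<close>

lemma exp_neg_norm_square_integrable:
  assumes c: "c > 0"
  shows "integrable lborel (\<lambda>x::'a::euclidean_space. exp (- c * (norm x)\<^sup>2))"
proof (rule integrableI_nonneg)
  define \<sigma> where "\<sigma> = sqrt (1 / (2 * c))"
  have \<sigma>: "\<sigma> > 0" "\<sigma>\<^sup>2 = 1 / (2 * c)"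
    using c by (auto simp: \<sigma>_def)
  have "integrable lborel (\<lambda>t. sqrt (2 * pi * \<sigma>\<^sup>2) * normal_density 0 \<sigma> t)"
    using \<sigma> by (intro integrable_mult_right integrable_normal_density) auto
  also have "(\<lambda>t. sqrt (2 * pi * \<sigma>\<^sup>2) * normal_density 0 \<sigma> t) = (\<lambda>t. exp (- c * t\<^sup>2))"
    using \<sigma> c by (auto simp: normal_density_def fun_eq_iff)
  finally have one_dim: "integrable lborel (\<lambda>t::real. exp (- c * t\<^sup>2))" .
  have "exp (- c * (norm x)\<^sup>2) = (\<Prod>b\<in>Basis. exp (- c * (x \<bullet> b)\<^sup>2))" for x :: 'a
  proof -
    have "(norm x)\<^sup>2 = (\<Sum>b\<in>Basis. (x \<bullet> b)\<^sup>2)"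
      unfolding power2_norm_eq_inner by (subst euclidean_inner) (simp add: power2_eq_square)
    then show ?thesis
      by (simp add: sum_distrib_left exp_sum flip: sum_negf)
  qed
  then have "(\<integral>\<^sup>+(x::'a). ennreal (exp (- c * (norm x)\<^sup>2)) \<partial>lborel)
      = (\<integral>\<^sup>+(x::'a). (\<Prod>b\<in>Basis. ennreal (exp (- c * (x \<bullet> b)\<^sup>2))) \<partial>lborel)"
    by (simp add: prod_ennreal)
  also have "\<dots> = (\<Prod>b\<in>(Basis::'a set). \<integral>\<^sup>+t. ennreal (exp (- c * t\<^sup>2)) \<partial>lborel)"
    by (subst nn_integral_lborel_prod) auto
  also have "\<dots> = ennreal ((\<integral>t. exp (- c * t\<^sup>2) \<partial>lborel) ^ DIM('a))"
    using nn_integral_eq_integral[OF one_dim] by (simp add: ennreal_power)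
  also have "\<dots> < \<infinity>" by simp
  finally show "(\<integral>\<^sup>+(x::'a). ennreal (exp (- c * (norm x)\<^sup>2)) \<partial>lborel) < \<infinity>" .
qed auto

section \<open>Gaussian densities: positivity, decay and score\<close>

lemma gaussian_density_pos:
  assumes "sym_pos_def P"
  shows "gaussian_density m P x > 0"
  using sym_pos_def_det_pos[OF assms] by (simp add: gaussian_density_def)

lemma continuous_on_gaussian_density:
  assumes "continuous_on S f" "continuous_on S g"
  shows "continuous_on S (\<lambda>z. gaussian_density (f z) P (g z))"
  unfolding gaussian_density_def divide_inverse[of _ "sqrt _"]
  by (intro continuous_intros assms bounded_linear.continuous_on[OF matrix_vector_mul_bounded_linear]) auto

text \<open>Coercivity of the inverse covariance gives decay at rate \<open>c / 2\<close> around
  \<open>m\<close>. Re-centring at the origin by \<open>|x|^2 \<le> 2 |x - m|^2 + 2 |m|^2\<close>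
  halves the rate and costs the factor \<open>exp (c |m|^2 / 2)\<close>.\<close>

lemma gaussian_density_upper_bound:
  assumes "sym_pos_def P"
  obtains c K where "c > 0" "K > 0"
    "\<And>x. gaussian_density m P x \<le> K * exp (- c * (norm x)\<^sup>2)"
proof -
  obtain c where c: "c > 0" "\<And>u. c * (norm u)\<^sup>2 \<le> u \<bullet> (matrix_inv P *v u)"
    using sym_pos_def_coercive[OF sym_pos_def_matrix_inv[OF assms]] by blast
  define N where "N = sqrt ((2 * pi) ^ CARD('a) * det P)"
  have N: "N > 0"
    using sym_pos_def_det_pos[OF assms] by (simp add: N_def)
  have "gaussian_density m P x \<le> exp (c * (norm m)\<^sup>2 / 2) / N * exp (- (c / 4) * (norm x)\<^sup>2)" for x
  proof -
    have "norm x \<le> norm (x - m) + norm m"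
      using norm_triangle_ineq[of "x - m" m] by simp
    then have "(norm x)\<^sup>2 \<le> (norm (x - m) + norm m)\<^sup>2"
      by (intro power_mono) auto
    also have "\<dots> \<le> 2 * (norm (x - m))\<^sup>2 + 2 * (norm m)\<^sup>2"
      using sum_squares_bound[of "norm (x - m)" "norm m"] by (simp add: power2_sum)
    finally have "c * (norm x)\<^sup>2 \<le> c * (2 * (norm (x - m))\<^sup>2 + 2 * (norm m)\<^sup>2)"
      using c(1) by simp
    also have "\<dots> = 2 * (c * (norm (x - m))\<^sup>2) + 2 * (c * (norm m)\<^sup>2)"
      by (simp add: algebra_simps)
    finally have "c * (norm x)\<^sup>2 \<le> 2 * (c * (norm (x - m))\<^sup>2) + 2 * (c * (norm m)\<^sup>2)" .
    then have "- ((x - m) \<bullet> (matrix_inv P *v (x - m))) / 2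
        \<le> c * (norm m)\<^sup>2 / 2 + - (c / 4) * (norm x)\<^sup>2"
      using c(2)[of "x - m"] by linarith
    then have "exp (- ((x - m) \<bullet> (matrix_inv P *v (x - m))) / 2)
        \<le> exp (c * (norm m)\<^sup>2 / 2) * exp (- (c / 4) * (norm x)\<^sup>2)"
      by (simp flip: exp_add)
    then show ?thesis
      using N by (simp add: gaussian_density_def N_def divide_right_mono)
  qed
  moreover have "c / 4 > 0" "exp (c * (norm m)\<^sup>2 / 2) / N > 0"
    using c N by auto
  ultimately show ?thesis
    using that by blast
qed

lemma integrable_gaussian_density:
  assumes "sym_pos_def P"
  shows "integrable lborel (gaussian_density m P)"
proof -
  obtain c K where c: "c > 0" "K > 0" "\<And>x. gaussian_density m P x \<le> K * exp (- c * (norm x)\<^sup>2)"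
    using gaussian_density_upper_bound[OF assms, of m] by blast
  show ?thesis
  proof (rule Bochner_Integration.integrable_bound)
    show "integrable lborel (\<lambda>x. K * exp (- c * (norm x)\<^sup>2))"
      by (intro integrable_mult_right exp_neg_norm_square_integrable c)
    show "gaussian_density m P \<in> borel_measurable lborel"
      using continuous_on_gaussian_density[of UNIV "\<lambda>_. m" "\<lambda>x. x" P]
      by (auto intro: borel_measurable_continuous_onI)
    show "AE x in lborel. norm (gaussian_density m P x) \<le> norm (K * exp (- c * (norm x)\<^sup>2))"
      using c(2,3) less_imp_le[OF gaussian_density_pos[OF assms]] by auto
  qed
qed

lemma score_gaussian_density:
  assumes "sym_pos_def P"
  shows "score (gaussian_density m P) y = - (matrix_inv P *v (y - m))"
proof -
  define A where "A = matrix_inv P"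
  define N where "N = sqrt ((2 * pi) ^ CARD('a) * det P)"
  have N: "N > 0"
    using sym_pos_def_det_pos[OF assms] by (simp add: N_def)
  have sym: "transpose A = A"
    using sym_pos_def_matrix_inv[OF assms] by (simp add: A_def sym_pos_def_def)
  have ln: "ln (gaussian_density m P z) = - ((z - m) \<bullet> (A *v (z - m))) / 2 - ln N" for z
  proof -
    have "gaussian_density m P z = exp (- ((z - m) \<bullet> (A *v (z - m))) / 2) / N"
      by (simp add: gaussian_density_def N_def A_def)
    then show ?thesis using N by (simp add: ln_div)
  qed
  have "partial_deriv i (\<lambda>z. ln (gaussian_density m P z)) y = - (A *v (y - m)) $ i" for i
  proof (rule partial_deriv_eqI)
    define u where "u = y - m"
    let ?e = "axis i (1::real)"
    have e: "?e \<bullet> v = v $ i" for v :: "real^'a"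
      by (simp add: inner_axis')
    \<comment> \<open>Along a coordinate line the log density is a quadratic polynomial in
      \<open>t\<close>. Symmetry of \<open>A\<close> merges the two cross terms, and the derivative
      at 0 is the linear coefficient.\<close>
    have "ln (gaussian_density m P (y + t *\<^sub>R ?e))
        = - (u \<bullet> (A *v u)) / 2 - t * (A *v u) $ i - t\<^sup>2 * (?e \<bullet> (A *v ?e)) / 2 - ln N" for t
    proof -
      have "y + t *\<^sub>R ?e - m = u + t *\<^sub>R ?e" by (simp add: u_def)
      moreover have "u \<bullet> (A *v ?e) = (A *v u) $ i"
        using symmetric_matrix_inner[OF sym, of u ?e] by (simp add: e inner_commute)
      ultimately show ?thesis
        by (simp add: ln linear_add[OF matrix_vector_mul_linear] linear_cmul[OF matrix_vector_mul_linear]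
            inner_add_left inner_add_right e power2_eq_square field_simps)
    qed
    then show "((\<lambda>t. ln (gaussian_density m P (y + t *\<^sub>R ?e)))
        has_real_derivative - (A *v (y - m)) $ i) (at 0)"
      by (auto intro!: derivative_eq_intros simp: u_def)
  qed
  then show ?thesis
    by (simp add: score_def grad_def A_def vec_eq_iff)
qed

section \<open>The DSM integrand and its growth under the kernel conditions\<close>

lemma differentiable_kernel_components:
  fixes k :: "real^'n \<Rightarrow> real"
  assumes "(\<lambda>z. (k z)\<^sup>2) differentiable (at y)"
  shows "(\<lambda>z. ((k z)\<^sup>2 *\<^sub>R z) $ i) differentiable (at y)"
  unfolding vector_scaleR_component real_scaleR_def
  by (intro differentiable_mult assms bounded_linear_imp_differentiable bounded_linear_vec_nth)

text \<open>The DSM integrand for a Gaussian likelihood with mean \<open>h\<close>. The divergence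
  of the flux is split into a part linear in \<open>h\<close> and the divergence of
  \<open>k^2 y\<close>, so that each part is controlled by its own kernel condition.\<close>

definition kernel_energy :: "real^'n^'n \<Rightarrow> (real^'n \<Rightarrow> real) \<Rightarrow> real^'n \<Rightarrow> real^'n \<Rightarrow> real" where
  "kernel_energy R k h y = (k y)\<^sup>2 * ((y - h) \<bullet> (matrix_inv R *v (y - h)))
     + 2 * ((\<Sum>i\<in>UNIV. partial_deriv i (\<lambda>z. (k z)\<^sup>2) y * h $ i) - divergence (\<lambda>z. (k z)\<^sup>2 *\<^sub>R z) y)"

text \<open>Since \<open>w\<close> is symmetric, the norm term is the inner product of score and
  flux; both terms of the integrand therefore follow once the flux is identified as
  \<open>k^2 (h - z)\<close>.\<close>

lemma DSM_integrand_gaussian: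
  fixes k :: "real^'n \<Rightarrow> real"
  assumes R: "sym_pos_def R" and k: "\<And>y. (\<lambda>z. (k z)\<^sup>2) differentiable (at y)"
    and w_def: "w = (\<lambda>y. k y *\<^sub>R matrix_sqrt R)"
  shows "(norm (transpose (w y) *v score (gaussian_density h R) y))\<^sup>2
      + 2 * divergence (\<lambda>z. (w z ** transpose (w z)) *v score (gaussian_density h R) z) y
    = kernel_energy R k h y"
proof -
  note score = score_gaussian_density[OF R]
  let ?S = "matrix_sqrt R"
  have symS: "transpose ?S = ?S"
    using matrix_sqrt(1)[OF R] by (simp add: sym_pos_def_def)
  have w: "w z *v u = k z *\<^sub>R (?S *v u)" "transpose (w z) = w z" for z u
    using symS by (auto simp: w_def scaleR_matrix_vector_assoc transpose_scalar)
  have flux: "(w z ** transpose (w z)) *v score (gaussian_density h R) z = (k z)\<^sup>2 *\<^sub>R (h - z)" for z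
  proof -
    have "?S *v (?S *v (matrix_inv R *v (z - h))) = z - h"
      by (metis matrix_vector_mul_assoc matrix_sqrt(2)[OF R] sym_pos_def_inverse_mult[OF R])
    moreover have "(w z ** transpose (w z)) *v (- u) = - ((k z)\<^sup>2 *\<^sub>R (?S *v (?S *v u)))" for u
      by (simp add: w linear_cmul[OF matrix_vector_mul_linear] linear_neg[OF matrix_vector_mul_linear]
          power2_eq_square flip: matrix_vector_mul_assoc)
    ultimately show ?thesis
      unfolding score by (simp only: scaleR_minus_right[symmetric] minus_diff_eq)
  qed
  have "(norm (transpose (w y) *v score (gaussian_density h R) y))\<^sup>2
      = score (gaussian_density h R) y \<bullet> ((w y ** transpose (w y)) *v score (gaussian_density h R) y)"
    using symmetric_matrix_inner[OF w(2)]
    by (simp add: power2_norm_eq_inner w(2) flip: matrix_vector_mul_assoc)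
  also have "\<dots> = (k y)\<^sup>2 * ((y - h) \<bullet> (matrix_inv R *v (y - h)))"
  proof -
    define u where "u = y - h"
    have "h - y = - u" by (simp add: u_def)
    then show ?thesis
      unfolding flux unfolding score u_def[symmetric] by (simp add: inner_commute)
  qed
  finally have energy: "(norm (transpose (w y) *v score (gaussian_density h R) y))\<^sup>2
      = (k y)\<^sup>2 * ((y - h) \<bullet> (matrix_inv R *v (y - h)))" .
  have part: "partial_deriv i (\<lambda>z. ((k z)\<^sup>2 *\<^sub>R (h - z)) $ i) y
      = partial_deriv i (\<lambda>z. (k z)\<^sup>2) y * h $ i - partial_deriv i (\<lambda>z. ((k z)\<^sup>2 *\<^sub>R z) $ i) y" for i
  proof (rule partial_deriv_eqI)
    from DERIV_diff[OF DERIV_cmult_right[OF differentiable_imp_partial_deriv[OF k], of y i "h $ i"]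
        differentiable_imp_partial_deriv[OF differentiable_kernel_components[of k y i, OF k], of i]]
    show "((\<lambda>t. ((k (y + t *\<^sub>R axis i 1))\<^sup>2 *\<^sub>R (h - (y + t *\<^sub>R axis i 1))) $ i) has_real_derivative
       partial_deriv i (\<lambda>z. (k z)\<^sup>2) y * h $ i - partial_deriv i (\<lambda>z. ((k z)\<^sup>2 *\<^sub>R z) $ i) y) (at 0)"
      by (simp add: algebra_simps)
  qed
  have "divergence (\<lambda>z. (k z)\<^sup>2 *\<^sub>R (h - z)) y
      = (\<Sum>i\<in>UNIV. partial_deriv i (\<lambda>z. (k z)\<^sup>2) y * h $ i) - divergence (\<lambda>z. (k z)\<^sup>2 *\<^sub>R z) y"
    unfolding divergence_def part by (simp add: sum_subtractf)
  then show ?thesis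
    unfolding energy flux kernel_energy_def by simp
qed

text \<open>Joint measurability is what makes the mean of the energy over \<open>y\<close> a
  measurable function of \<open>x\<close>.\<close>

lemma borel_measurable_kernel_energy:
  fixes H :: "real^'m^'n"
  assumes k: "\<And>y. (\<lambda>z. (k z)\<^sup>2) differentiable (at y)"
  shows "(\<lambda>(x, y). kernel_energy R k (H *v x) y) \<in> borel_measurable (borel \<Otimes>\<^sub>M borel)"
proof -
  have [measurable]: "(\<lambda>z. (k z)\<^sup>2) \<in> borel_measurable borel"
    using k by (intro borel_measurable_continuous_onI)
      (simp add: differentiable_imp_continuous_on differentiable_on_def)
  have [measurable]: "partial_deriv i (\<lambda>z. (k z)\<^sup>2) \<in> borel_measurable borel" for i
    by (rule borel_measurable_partial_deriv[OF k])
  have [measurable]: "divergence (\<lambda>z. (k z)\<^sup>2 *\<^sub>R z) \<in> borel_measurable borel"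
    unfolding divergence_def
    by (intro borel_measurable_sum borel_measurable_partial_deriv differentiable_kernel_components k)
  have [measurable]: "(\<lambda>z. (snd z - H *v fst z) \<bullet> (matrix_inv R *v (snd z - H *v fst z)))
      \<in> borel_measurable (borel \<Otimes>\<^sub>M borel)"
    unfolding borel_prod
    by (intro borel_measurable_continuous_onI continuous_intros
        bounded_linear.continuous_on[OF matrix_vector_mul_bounded_linear])
  have [measurable]: "(\<lambda>x. (H *v x) $ i) \<in> borel_measurable borel" for i
    by (intro borel_measurable_continuous_onI continuous_intros
        bounded_linear.continuous_on[OF matrix_vector_mul_bounded_linear])
  show ?thesis
    unfolding kernel_energy_def case_prod_beta' by measurable
qed

lemma kernel_energy_bounds:
  fixes k :: "real^'n \<Rightarrow> real" and R :: "real^'n^'n"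
  assumes R: "sym_pos_def R" and k: "kernel_conditions k"
  obtains C where "C > 0" "\<And>h y. \<bar>kernel_energy R k h y\<bar> \<le> C * (1 + (norm h)\<^sup>2)"
    "\<And>h y. - C * (1 + norm h) \<le> kernel_energy R k h y"
proof -
  obtain kbar where kbar: "\<And>y. 0 < k y" "\<And>y. k y \<le> kbar"
    using k unfolding kernel_conditions_def by blast
  obtain B1 where B1: "\<And>y. \<bar>norm y * k y\<bar> \<le> B1"
    using k unfolding kernel_conditions_def bounded_iff by auto
  obtain B2 where B2: "\<And>y. \<bar>divergence (\<lambda>y. (k y)\<^sup>2 *\<^sub>R y) y\<bar> \<le> B2"
    using k unfolding kernel_conditions_def bounded_iff by auto
  have "\<forall>i. \<exists>B. \<forall>y. \<bar>partial_deriv i (\<lambda>y. (k y)\<^sup>2) y\<bar> \<le> B"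
    using k unfolding kernel_conditions_def bounded_iff by auto
  then obtain B3 where B3: "\<And>i y. \<bar>partial_deriv i (\<lambda>y. (k y)\<^sup>2) y\<bar> \<le> B3 i"
    by metis
  obtain K where K: "K > 0" "\<And>u. norm (matrix_inv R *v u) \<le> K * norm u"
    using bounded_linear.pos_bounded[OF matrix_vector_mul_bounded_linear[of "matrix_inv R"]]
    by (auto simp: mult.commute)
  define S where "S = (\<Sum>i\<in>UNIV. B3 i)"
  have B2_nn: "B2 \<ge> 0" using B2[of undefined] by linarith
  have B3_nn: "B3 i \<ge> 0" for i using B3[of i undefined] by linarith
  have S_nn: "S \<ge> 0" by (simp add: S_def sum_nonneg B3_nn)
  have drift: "\<bar>\<Sum>i\<in>UNIV. partial_deriv i (\<lambda>z. (k z)\<^sup>2) y * h $ i\<bar> \<le> S * norm h" for h y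
  proof -
    have "\<bar>\<Sum>i\<in>UNIV. partial_deriv i (\<lambda>z. (k z)\<^sup>2) y * h $ i\<bar>
        \<le> (\<Sum>i\<in>UNIV. \<bar>partial_deriv i (\<lambda>z. (k z)\<^sup>2) y * h $ i\<bar>)"
      by (rule sum_abs)
    also have "\<dots> \<le> (\<Sum>i\<in>UNIV. B3 i * norm h)"
      unfolding abs_mult by (intro sum_mono mult_mono B3 component_le_norm_cart B3_nn) auto
    finally show ?thesis by (simp add: S_def sum_distrib_right)
  qed
  define quad where "quad = (\<lambda>h y. (k y)\<^sup>2 * ((y - h) \<bullet> (matrix_inv R *v (y - h))))"
  have quad_nn: "quad h y \<ge> 0" for h y
    using sym_pos_def_matrix_inv[OF R] by (cases "y - h = 0") (auto simp: quad_def sym_pos_def_def less_imp_le)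
  \<comment> \<open>The factor \<open>k^2\<close> is paired with \<open>|y|^2\<close> through the
    bound on \<open>norm y * k y\<close>, and with \<open>|h|^2\<close> through the bound on
    \<open>k\<close>.\<close>
  have quad_le: "quad h y \<le> 2 * K * B1\<^sup>2 + 2 * K * kbar\<^sup>2 * (norm h)\<^sup>2" for h y
  proof -
    have "(y - h) \<bullet> (matrix_inv R *v (y - h)) \<le> norm (y - h) * (K * norm (y - h))"
      by (meson K(2) mult_left_mono norm_cauchy_schwarz norm_ge_zero order_trans)
    also have "\<dots> = K * (norm (y - h))\<^sup>2"
      by (simp add: power2_eq_square)
    also have "\<dots> \<le> K * (norm y + norm h)\<^sup>2"
      using K(1) by (intro mult_left_mono power_mono norm_triangle_ineq4) auto
    also have "\<dots> \<le> K * (2 * (norm y)\<^sup>2 + 2 * (norm h)\<^sup>2)"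
      using K(1) sum_squares_bound[of "norm y" "norm h"] by (simp add: power2_sum)
    finally have "quad h y \<le> (k y)\<^sup>2 * (K * (2 * (norm y)\<^sup>2 + 2 * (norm h)\<^sup>2))"
      unfolding quad_def by (intro mult_left_mono) auto
    also have "\<dots> = 2 * K * (norm y * k y)\<^sup>2 + 2 * K * (k y)\<^sup>2 * (norm h)\<^sup>2"
      by (simp add: algebra_simps power_mult_distrib)
    also have "\<dots> \<le> 2 * K * B1\<^sup>2 + 2 * K * kbar\<^sup>2 * (norm h)\<^sup>2"
      using K(1) B1[of y] kbar(1)[of y] kbar(2)[of y]
      by (intro add_mono mult_left_mono mult_right_mono power_mono) (auto simp: less_imp_le)
    finally show ?thesis .
  qed
  \<comment> \<open>Large enough for every sum of coefficients in \<open>C_parts\<close>; the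
    leading 1 ensures positivity.\<close>
  define C where "C = 1 + 2 * K * B1\<^sup>2 + 2 * K * kbar\<^sup>2 + 2 * S + 2 * B2"
  have C_parts: "2 * S + 2 * B2 \<le> C"
      "2 * K * B1\<^sup>2 + 2 * S + 2 * B2 \<le> C" "2 * K * kbar\<^sup>2 + 2 * S \<le> C" "C > 0"
    using K S_nn B2_nn unfolding C_def by (auto intro!: add_nonneg_nonneg add_pos_nonneg)
  have upper: "\<bar>kernel_energy R k h y\<bar> \<le> C * (1 + (norm h)\<^sup>2)" for h y
  proof -
    have "norm h \<le> 1 + (norm h)\<^sup>2"
      using sum_squares_bound[of "norm h" 1, simplified] norm_ge_zero[of h] by linarith
    then have "S * norm h \<le> S * (1 + (norm h)\<^sup>2)"
      using S_nn by (rule mult_left_mono)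
    then have "\<bar>kernel_energy R k h y\<bar>
        \<le> (2 * K * B1\<^sup>2 + 2 * S + 2 * B2) + (2 * K * kbar\<^sup>2 + 2 * S) * (norm h)\<^sup>2"
      using quad_nn[of h y] quad_le[of h y] drift[of y h] B2[of y]
      unfolding kernel_energy_def quad_def by (simp add: algebra_simps)
    also have "\<dots> \<le> C + C * (norm h)\<^sup>2"
      using C_parts by (intro add_mono mult_right_mono) auto
    finally show ?thesis by (simp add: algebra_simps)
  qed
  have lower: "- C * (1 + norm h) \<le> kernel_energy R k h y" for h y
  proof -
    have "2 * B2 + 2 * S * norm h \<le> C + C * norm h"
      using C_parts S_nn B2_nn by (intro add_mono mult_right_mono) auto
    then show ?thesis
      using quad_nn[of h y] drift[of y h] B2[of y]
      unfolding kernel_energy_def quad_def by (simp add: algebra_simps)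
  qed
  show ?thesis
    using that[OF C_parts(4) upper lower] .
qed

subsection \<open>Contaminated measures and the observation marginal\<close>

lemma sets_contamination [simp, measurable_cong]: "sets (contamination q \<epsilon> y0) = sets borel"
  by (simp add: contamination_def sets.sigma_sets_eq[of borel, simplified])

lemma space_contamination [simp]: "space (contamination q \<epsilon> y0) = UNIV"
  by (simp add: contamination_def)

text \<open>The contamination is given as a set function, so its integral is obtained by induction
  from indicators through sums and increasing limits. Any real \<epsilon> is allowed, as
  \<open>ennreal\<close> truncates negative weights on both sides.\<close>

lemma nn_integral_contamination:
  assumes "f \<in> borel_measurable borel"
  shows "(\<integral>\<^sup>+y. f y \<partial>contamination q \<epsilon> y0)
    = ennreal (1 - \<epsilon>) * (\<integral>\<^sup>+y. f y \<partial>density lborel (\<lambda>y. ennreal (q y))) + ennreal \<epsilon> * f y0"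
  using assms
proof (induction rule: borel_measurable_induct)
  case (cong f g)
  then show ?case by (simp add: fun_eq_iff)
next
  case (set A)
  then show ?case
    by (simp add: emeasure_contamination)
next
  case (mult u c)
  then show ?case
    by (simp add: nn_integral_cmult distrib_left mult_ac)
next
  case (add u v)
  then show ?case
    by (simp add: nn_integral_add distrib_left add_ac)
next
  case (seq U)
  let ?M = "density lborel (\<lambda>y. ennreal (q y))"
  have [measurable]: "U i \<in> borel_measurable borel" for i by (rule seq)
  have inc: "incseq (\<lambda>i. integral\<^sup>N ?M (U i))" "incseq (\<lambda>i. U i y0)"
    using seq(3) by (auto simp: incseq_def le_fun_def intro!: nn_integral_mono)
  have "(\<integral>\<^sup>+y. (SUP i. U i) y \<partial>contamination q \<epsilon> y0)
      = (SUP i. ennreal (1 - \<epsilon>) * integral\<^sup>N ?M (U i) + ennreal \<epsilon> * U i y0)"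
    unfolding SUP_apply
    by (subst nn_integral_monotone_convergence_SUP) (use seq in auto)
  also have "\<dots> = (SUP i. ennreal (1 - \<epsilon>) * integral\<^sup>N ?M (U i)) + (SUP i. ennreal \<epsilon> * U i y0)"
    using inc by (intro ennreal_SUP_add) (auto simp: incseq_def intro!: mult_left_mono)
  also have "\<dots> = ennreal (1 - \<epsilon>) * (SUP i. integral\<^sup>N ?M (U i)) + ennreal \<epsilon> * (SUP i. U i y0)"
    by (simp add: SUP_mult_left_ennreal)
  also have "(SUP i. integral\<^sup>N ?M (U i)) = (\<integral>\<^sup>+y. (SUP i. U i) y \<partial>?M)"
    unfolding SUP_apply
    by (subst nn_integral_monotone_convergence_SUP) (use seq in auto)
  finally show ?case by (simp only: SUP_apply)
qed

text \<open>The nonnegative formula is applied to the positive and negative parts of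
  \<open>f\<close>; integrability makes all terms finite, so passing back to the reals is
  additive.\<close>

lemma integral_contamination:
  assumes \<epsilon>: "\<epsilon> \<in> {0..1}"
    and f: "integrable (density lborel (\<lambda>y. ennreal (q y))) f"
  shows "(\<integral>y. f y \<partial>contamination q \<epsilon> y0)
    = (1 - \<epsilon>) * (\<integral>y. f y \<partial>density lborel (\<lambda>y. ennreal (q y))) + \<epsilon> * f y0"
proof -
  let ?M = "density lborel (\<lambda>y. ennreal (q y))" and ?N = "contamination q \<epsilon> y0"
  have [measurable]: "f \<in> borel_measurable borel"
    using borel_measurable_integrable[OF f] by simp
  have fin: "(\<integral>\<^sup>+y. ennreal (g y) \<partial>?M) < \<infinity>" if "\<And>y. g y \<le> \<bar>f y\<bar>" for g
  proof -
    have "(\<integral>\<^sup>+y. ennreal (g y) \<partial>?M) \<le> (\<integral>\<^sup>+y. ennreal (norm (f y)) \<partial>?M)"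
      using that by (intro nn_integral_mono) (simp add: ennreal_leI)
    then show ?thesis
      using f unfolding integrable_iff_bounded by (meson order_le_less_trans)
  qed
  \<comment> \<open>Used for \<open>f\<close> and \<open>- f\<close>. The \<open>max 0\<close>
    records the truncation by \<open>ennreal\<close> at the point mass, and the difference of the
    two truncated values is again \<open>f y0\<close>.\<close>
  have part: "enn2real (\<integral>\<^sup>+y. ennreal (g y) \<partial>?N)
      = (1 - \<epsilon>) * enn2real (\<integral>\<^sup>+y. ennreal (g y) \<partial>?M) + \<epsilon> * max 0 (g y0)"
    if "\<And>y. g y \<le> \<bar>f y\<bar>" and [measurable]: "g \<in> borel_measurable borel" for g
    using \<epsilon> fin[of g] that(1)
    by (simp add: nn_integral_contamination enn2real_plus ennreal_mult_less_top enn2real_mult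
        max_def ennreal_neg)
  have "integrable ?N f"
    unfolding integrable_iff_bounded
    using fin[of "\<lambda>y. \<bar>f y\<bar>"]
    by (simp add: nn_integral_contamination ennreal_mult_less_top)
  then have "(\<integral>y. f y \<partial>?N)
      = enn2real (\<integral>\<^sup>+y. ennreal (f y) \<partial>?N) - enn2real (\<integral>\<^sup>+y. ennreal (- f y) \<partial>?N)"
    by (rule real_lebesgue_integral_def)
  also have "\<dots> = (1 - \<epsilon>) * (enn2real (\<integral>\<^sup>+y. ennreal (f y) \<partial>?M) - enn2real (\<integral>\<^sup>+y. ennreal (- f y) \<partial>?M))
      + \<epsilon> * (max 0 (f y0) - max 0 (- f y0))"
    by (subst (1 2) part) (auto simp: algebra_simps)
  also have "\<dots> = (1 - \<epsilon>) * (\<integral>y. f y \<partial>?M) + \<epsilon> * f y0"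
    unfolding real_lebesgue_integral_def[OF f] by (simp add: max_def)
  finally show ?thesis .
qed

text \<open>By Tonelli the \<open>y\<close>-integral may be taken first; translation invariance
  makes it independent of \<open>x\<close>, so the total mass is bounded by a product of two finite
  Gaussian integrals.\<close>

lemma finite_measure_obs_marginal:
  fixes mf :: "real^'x" and H :: "real^'x^'y"
  assumes P: "sym_pos_def P" and R: "sym_pos_def R"
  shows "finite_measure (density lborel
    (\<lambda>y. ennreal (obs_marginal (gaussian_density mf P) (\<lambda>x. gaussian_density (H *v x) R) y)))"
proof -
  let ?p = "gaussian_density mf P" and ?l = "\<lambda>x. gaussian_density (H *v x) R"
  have nn: "?p x \<ge> 0" "?l x y \<ge> 0" for x y
    using P R by (auto intro: less_imp_le gaussian_density_pos)
  have cont: "continuous_on UNIV (\<lambda>z. ?l (fst z) (snd z) * ?p (fst z))"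
    by (intro continuous_intros continuous_on_gaussian_density
        bounded_linear.continuous_on[OF matrix_vector_mul_bounded_linear])
  have joint: "(\<lambda>z. ?l (fst z) (snd z) * ?p (fst z)) \<in> borel_measurable (borel \<Otimes>\<^sub>M borel)"
    unfolding borel_prod by (rule borel_measurable_continuous_onI[OF cont])
  have joint_xy [measurable]: "(\<lambda>(x, y). ?l x y * ?p x) \<in> borel_measurable (borel \<Otimes>\<^sub>M borel)"
    using joint by (simp add: case_prod_beta')
  have joint_yx [measurable]: "(\<lambda>(y, x). ?l x y * ?p x) \<in> borel_measurable (borel \<Otimes>\<^sub>M borel)"
    by measurable
  have [measurable]: "?p \<in> borel_measurable borel"
    by (intro borel_measurable_continuous_onI continuous_on_gaussian_density continuous_intros)
  have meas_l [measurable]: "gaussian_density m R \<in> borel_measurable borel" for m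
    by (intro borel_measurable_continuous_onI continuous_on_gaussian_density continuous_intros)
  have [measurable]: "obs_marginal ?p ?l \<in> borel_measurable borel"
    unfolding obs_marginal_def by measurable
  have pair: "pair_sigma_finite (lborel :: (real^'x) measure) (lborel :: (real^'y) measure)" ..
  have shift: "(\<integral>\<^sup>+y. ennreal (gaussian_density m R y) \<partial>lborel)
      = (\<integral>\<^sup>+y. ennreal (gaussian_density 0 R y) \<partial>lborel)" for m :: "real^'y"
  proof -
    have "(\<integral>\<^sup>+y. ennreal (gaussian_density m R y) \<partial>lborel)
        = (\<integral>\<^sup>+y. ennreal (gaussian_density m R y) \<partial>distr lborel borel ((+) m))"
      by (simp add: lborel_distr_plus)
    also have "\<dots> = (\<integral>\<^sup>+y. ennreal (gaussian_density m R (m + y)) \<partial>lborel)"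
      by (subst nn_integral_distr) auto
    finally show ?thesis by (simp add: gaussian_density_def)
  qed
  have fin: "(\<integral>\<^sup>+x. ennreal (gaussian_density m Q x) \<partial>lborel) < \<infinity>" if "sym_pos_def Q"
    for m :: "real^'z" and Q
    using integrable_gaussian_density[OF that, of m] gaussian_density_pos[OF that, of m]
    unfolding integrable_iff_bounded by (simp add: less_imp_le)
  \<comment> \<open>Where the inner integrand is not integrable, the Bochner integral defaults to 0,
    so an inequality holds in every case and suffices for finiteness.\<close>
  have "(\<integral>\<^sup>+y. ennreal (obs_marginal ?p ?l y) \<partial>lborel)
      \<le> (\<integral>\<^sup>+y. (\<integral>\<^sup>+x. ennreal (?l x y * ?p x) \<partial>lborel) \<partial>lborel)"
  proof (rule nn_integral_mono)
    fix y
    show "ennreal (obs_marginal ?p ?l y) \<le> (\<integral>\<^sup>+x. ennreal (?l x y * ?p x) \<partial>lborel)"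
    proof (cases "integrable lborel (\<lambda>x. ?l x y * ?p x)")
      case True
      then show ?thesis
        unfolding obs_marginal_def by (subst nn_integral_eq_integral) (use nn in auto)
    qed (simp add: obs_marginal_def not_integrable_integral_eq)
  qed
  also have "\<dots> = (\<integral>\<^sup>+x. (\<integral>\<^sup>+y. ennreal (?l x y * ?p x) \<partial>lborel) \<partial>lborel)"
    by (rule pair_sigma_finite.Fubini'[OF pair]) measurable
  also have "\<dots> = (\<integral>\<^sup>+x. (\<integral>\<^sup>+y. ennreal (gaussian_density 0 R y) \<partial>lborel) * ennreal (?p x) \<partial>lborel)"
    using nn by (simp add: ennreal_mult nn_integral_multc shift[of "H *v _"])
  also have "\<dots> = (\<integral>\<^sup>+y. ennreal (gaussian_density 0 R y) \<partial>lborel) * (\<integral>\<^sup>+x. ennreal (?p x) \<partial>lborel)"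
    by (intro nn_integral_cmult) measurable
  also have "\<dots> < \<infinity>"
    using fin[OF R] fin[OF P] by (simp add: ennreal_mult_less_top)
  finally show ?thesis
    by (intro finite_measureI) (simp add: emeasure_density less_top)
qed

subsection \<open>Differentiation in the contamination parameter\<close>

text \<open>A mean value estimate obtained from \<open>1 + t \<le> exp t\<close>; it bounds
  difference quotients of exponentials.\<close>

lemma exp_diff_le:
  fixes u v L :: real
  assumes "u \<le> L" "v \<le> L"
  shows "\<bar>exp u - exp v\<bar> \<le> \<bar>u - v\<bar> * exp L"
proof -
  have *: "exp s - exp t \<le> (s - t) * exp L" if "t \<le> s" "s \<le> L" for s t :: real
  proof -
    have "exp s - exp t = exp s * (1 - exp (t - s))"
      by (simp add: algebra_simps exp_diff)
    also have "\<dots> \<le> exp s * (s - t)"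
      using exp_ge_add_one_self[of "t - s"] by (intro mult_left_mono) (linarith, simp)
    also have "\<dots> \<le> exp L * (s - t)"
      using that by (intro mult_right_mono) auto
    finally show ?thesis by (simp add: mult.commute)
  qed
  show ?thesis
    using *[of v u] *[of u v] assms by (cases "v \<le> u") auto
qed

text \<open>Differentiation under the integral by dominated convergence. The exponent is affine in
  \<epsilon> with slope \<open>a - b\<close>, so every difference quotient on the unit interval is
  at most \<open>\<bar>a - b\<bar> * exp L\<close>.\<close>

lemma tilted_integral_has_derivative:
  fixes f a b L :: "'a \<Rightarrow> real"
  assumes [measurable]: "f \<in> borel_measurable M" "a \<in> borel_measurable M" "b \<in> borel_measurable M"
    and f: "\<And>x. f x \<ge> 0" and L: "\<And>x. - a x \<le> L x" "\<And>x. - b x \<le> L x"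
    and int: "integrable M (\<lambda>x. f x * exp (L x))" "integrable M (\<lambda>x. f x * \<bar>a x - b x\<bar> * exp (L x))"
  shows "((\<lambda>\<epsilon>. \<integral>x. f x * exp (- ((1 - \<epsilon>) * a x + \<epsilon> * b x)) \<partial>M) has_real_derivative
    (\<integral>x. f x * ((a x - b x) * exp (- a x)) \<partial>M)) (at 0 within {0..1})"
proof -
  define E where "E = (\<lambda>\<epsilon> x. - ((1 - \<epsilon>) * a x + \<epsilon> * b x))"
  have [measurable]: "E \<epsilon> \<in> borel_measurable M" for \<epsilon>
    unfolding E_def by measurable
  \<comment> \<open>On the unit interval the exponent is a convex combination of
    \<open>- a x\<close> and \<open>- b x\<close>.\<close>
  have E_le: "E \<epsilon> x \<le> L x" if "\<epsilon> \<in> {0..1}" for \<epsilon> x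
  proof -
    have "E \<epsilon> x = (1 - \<epsilon>) * (- a x) + \<epsilon> * (- b x)"
      by (simp add: E_def)
    also have "\<dots> \<le> (1 - \<epsilon>) * L x + \<epsilon> * L x"
      using that L by (intro add_mono mult_left_mono) auto
    finally show ?thesis by (simp add: algebra_simps)
  qed
  have E_int: "integrable M (\<lambda>x. f x * exp (E \<epsilon> x))" if "\<epsilon> \<in> {0..1}" for \<epsilon>
    by (rule Bochner_Integration.integrable_bound[OF int(1)])
      (use f E_le[OF that] in \<open>auto intro!: mult_left_mono\<close>)
  have "(\<lambda>n. ((\<integral>x. f x * exp (E (X n) x) \<partial>M) - (\<integral>x. f x * exp (E 0 x) \<partial>M)) / X n)
      \<longlonglongrightarrow> (\<integral>x. f x * ((a x - b x) * exp (- a x)) \<partial>M)"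
    if X: "\<And>n. X n \<in> {0..1} - {0}" and lim: "X \<longlonglongrightarrow> 0" for X
  proof -
    have "(\<lambda>n. \<integral>x. f x * ((exp (E (X n) x) - exp (E 0 x)) / X n) \<partial>M)
        \<longlonglongrightarrow> (\<integral>x. f x * ((a x - b x) * exp (- a x)) \<partial>M)"
    proof (rule integral_dominated_convergence[OF _ _ int(2)])
      show "AE x in M. (\<lambda>n. f x * ((exp (E (X n) x) - exp (E 0 x)) / X n))
          \<longlonglongrightarrow> f x * ((a x - b x) * exp (- a x))"
      proof (rule AE_I2)
        fix x
        have "((\<lambda>\<epsilon>. exp (E \<epsilon> x)) has_real_derivative (a x - b x) * exp (- a x)) (at 0)"
          unfolding E_def by (auto intro!: derivative_eq_intros)
        then have "((\<lambda>\<epsilon>. (exp (E \<epsilon> x) - exp (E 0 x)) / \<epsilon>) \<longlongrightarrow> (a x - b x) * exp (- a x)) (at 0)"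
          by (simp add: DERIV_def)
        moreover have "filterlim X (at 0) sequentially"
          using X lim by (auto simp: filterlim_at)
        ultimately have "(\<lambda>n. (exp (E (X n) x) - exp (E 0 x)) / X n) \<longlonglongrightarrow> (a x - b x) * exp (- a x)"
          by (rule filterlim_compose)
        then show "(\<lambda>n. f x * ((exp (E (X n) x) - exp (E 0 x)) / X n))
            \<longlonglongrightarrow> f x * ((a x - b x) * exp (- a x))"
          by (rule tendsto_mult_left)
      qed
      show "AE x in M. norm (f x * ((exp (E (X n) x) - exp (E 0 x)) / X n))
          \<le> f x * \<bar>a x - b x\<bar> * exp (L x)" for n
      proof (rule AE_I2)
        fix x
        have Xn: "X n > 0" "X n \<in> {0..1}" using X[of n] by auto
        have "\<bar>exp (E (X n) x) - exp (E 0 x)\<bar> \<le> \<bar>E (X n) x - E 0 x\<bar> * exp (L x)"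
          by (intro exp_diff_le E_le Xn) auto
        also have "E (X n) x - E 0 x = X n * (a x - b x)"
          by (simp add: E_def algebra_simps)
        also have "\<bar>X n * (a x - b x)\<bar> = X n * \<bar>a x - b x\<bar>"
          using Xn(1) by (simp add: abs_mult)
        finally have "\<bar>exp (E (X n) x) - exp (E 0 x)\<bar> / X n \<le> \<bar>a x - b x\<bar> * exp (L x)"
          using Xn(1) by (simp add: divide_le_eq mult_ac)
        then have "f x * (\<bar>exp (E (X n) x) - exp (E 0 x)\<bar> / X n) \<le> f x * (\<bar>a x - b x\<bar> * exp (L x))"
          using f by (rule mult_left_mono)
        then show "norm (f x * ((exp (E (X n) x) - exp (E 0 x)) / X n))
            \<le> f x * \<bar>a x - b x\<bar> * exp (L x)"
          using f[of x] Xn(1) by (simp add: abs_mult)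
      qed
    qed measurable
    moreover have "(\<integral>x. f x * ((exp (E (X n) x) - exp (E 0 x)) / X n) \<partial>M)
        = ((\<integral>x. f x * exp (E (X n) x) \<partial>M) - (\<integral>x. f x * exp (E 0 x) \<partial>M)) / X n" for n
    proof -
      have "(\<integral>x. f x * ((exp (E (X n) x) - exp (E 0 x)) / X n) \<partial>M)
          = (\<integral>x. (f x * exp (E (X n) x) - f x * exp (E 0 x)) / X n \<partial>M)"
        by (simp add: algebra_simps)
      then show ?thesis
        using X[of n] by (simp add: Bochner_Integration.integral_diff[OF E_int E_int])
    qed
    ultimately show ?thesis by (simp only:)
  qed
  then show ?thesis
    unfolding has_field_derivative_iff tendsto_at_iff_sequentially comp_def E_def by simp
qed

text \<open>Half of the decay rate \<open>c\<close> is spent: a quarter absorbs the polynomial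
  factor, another quarter the exponential of a linear function.\<close>

lemma polynomial_exp_gaussian_bound:
  fixes c C :: real
  assumes c: "c > 0"
  obtains K where "K > 0"
    "\<And>r. (1 + r\<^sup>2) * exp (C * (1 + r)) * exp (- c * r\<^sup>2) \<le> K * exp (- (c / 2) * r\<^sup>2)"
proof -
  define K where "K = (1 + 4 / c) * exp (C + C\<^sup>2 / c)"
  have "(1 + r\<^sup>2) * exp (C * (1 + r)) * exp (- c * r\<^sup>2) \<le> K * exp (- (c / 2) * r\<^sup>2)" for r
  proof -
    have "1 + r\<^sup>2 \<le> (1 + 4 / c) * (1 + c / 4 * r\<^sup>2)"
      using c by (simp add: field_simps)
    also have "\<dots> \<le> (1 + 4 / c) * exp (c / 4 * r\<^sup>2)"
      using c exp_ge_add_one_self[of "c / 4 * r\<^sup>2"] by (intro mult_left_mono) auto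
    finally have poly: "1 + r\<^sup>2 \<le> (1 + 4 / c) * exp (c / 4 * r\<^sup>2)" .
    \<comment> \<open>Completing the square yields \<open>C * r \<le> c / 4 * r^2 + C^2 / c\<close>,
      the source of the exponential constant in \<open>K\<close>.\<close>
    have "0 \<le> (c * r / 2 - C)\<^sup>2 / c" using c by simp
    also have "\<dots> = c / 4 * r\<^sup>2 - C * r + C\<^sup>2 / c"
      using c by (simp add: field_simps power2_eq_square)
    finally have expo: "exp (C * (1 + r)) \<le> exp (C + C\<^sup>2 / c + c / 4 * r\<^sup>2)"
      by (simp add: algebra_simps)
    have "(1 + r\<^sup>2) * exp (C * (1 + r)) * exp (- c * r\<^sup>2)
        \<le> ((1 + 4 / c) * exp (c / 4 * r\<^sup>2)) * exp (C + C\<^sup>2 / c + c / 4 * r\<^sup>2) * exp (- c * r\<^sup>2)"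
      by (intro mult_right_mono mult_mono poly expo) (use c in auto)
    also have "\<dots> = (1 + 4 / c) * (exp (c / 4 * r\<^sup>2) * exp (C + C\<^sup>2 / c + c / 4 * r\<^sup>2) * exp (- c * r\<^sup>2))"
      by (simp only: mult.assoc)
    also have "\<dots> = K * exp (- (c / 2) * r\<^sup>2)"
      unfolding K_def mult.assoc exp_add[symmetric] by (simp add: algebra_simps)
    finally show ?thesis .
  qed
  moreover have "K > 0"
    using c by (simp add: K_def add_pos_pos)
  ultimately show ?thesis using that by blast
qed

text \<open>The derivative is one-sided because the mixture has nonnegative weights only on the unit
  interval; 0 is a limit point of that interval, so \<open>PIF\<close> is determined uniquely. The
  supremum is taken in \<open>ereal\<close>, where finiteness from above expresses
  boundedness.\<close>

theorem theorem1:
  fixes mf :: "real^'x" and Pf :: "real^'x^'x" and H :: "real^'x^'y" and R :: "real^'y^'y"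
    and k :: "real^'y \<Rightarrow> real" and \<pi> :: "real^'y \<Rightarrow> real"
    and prior :: "real^'x \<Rightarrow> real" and lik :: "real^'x \<Rightarrow> real^'y \<Rightarrow> real"
    and w :: "real^'y \<Rightarrow> real^'y^'y"
  defines "prior \<equiv> gaussian_density mf Pf"
    and "lik \<equiv> \<lambda>x. gaussian_density (H *v x) R"
    and "w \<equiv> \<lambda>y. k y *\<^sub>R matrix_sqrt R"
  assumes "sym_pos_def Pf" and "sym_pos_def R"
    and "kernel_conditions k"
    and "prob_density \<pi>" and "regularity_conditions lik w \<pi>"
  shows "\<exists>PIF :: real^'x \<Rightarrow> real^'y \<Rightarrow> real.
    (\<forall>x y0. ((\<lambda>\<epsilon>. DSM_posterior prior lik w (contamination (obs_marginal prior lik) \<epsilon> y0) x)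
               has_real_derivative PIF x y0) (at 0 within {0..1})) \<and>
    (SUP (x, y0) \<in> UNIV. ereal (PIF x y0)) < \<infinity>"
proof -
  note P = \<open>sym_pos_def Pf\<close> and R = \<open>sym_pos_def R\<close> and k = \<open>kernel_conditions k\<close>
  have dk: "\<And>y. (\<lambda>z. (k z)\<^sup>2) differentiable (at y)"
    using k by (auto simp: kernel_conditions_def)
  define J where "J = (\<lambda>x y. kernel_energy R k (H *v x) y)"
  define q where "q = obs_marginal prior lik"
  define M where "M = density lborel (\<lambda>y. ennreal (q y))"
  define a where "a = (\<lambda>x. \<integral>y. J x y \<partial>M)"
  interpret M: finite_measure M
    unfolding M_def q_def prior_def lik_def by (rule finite_measure_obs_marginal[OF P R])
  have sets_M [measurable_cong]: "sets M = sets borel" by (simp add: M_def)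
  have J_meas [measurable]: "(\<lambda>(x, y). J x y) \<in> borel_measurable (borel \<Otimes>\<^sub>M borel)"
    unfolding J_def by (rule borel_measurable_kernel_energy[OF dk])
  have prior_pos: "prior x > 0" for x
    unfolding prior_def by (rule gaussian_density_pos[OF P])
  have prior_meas [measurable]: "prior \<in> borel_measurable borel"
    unfolding prior_def
    by (intro borel_measurable_continuous_onI continuous_on_gaussian_density continuous_intros)

  \<comment> \<open>Growth of \<open>J\<close> and of its mean \<open>a\<close>, uniformly in the
    observation\<close>
  obtain C0 where C0: "C0 > 0" "\<And>h y. \<bar>kernel_energy R k h y\<bar> \<le> C0 * (1 + (norm h)\<^sup>2)"
      "\<And>h y. - C0 * (1 + norm h) \<le> kernel_energy R k h y"
    using kernel_energy_bounds[OF R k] by blast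
  obtain K where K: "K > 0" "\<And>x. norm (H *v x) \<le> K * norm x"
    using bounded_linear.pos_bounded[OF matrix_vector_mul_bounded_linear[of H]]
    by (auto simp: mult.commute)
  \<comment> \<open>Replaces \<open>norm (H *v x)\<close> by \<open>norm x\<close> in both bounds at
    once: \<open>K\<close> serves the linear one and \<open>K^2\<close> the quadratic one.\<close>
  define C1 where "C1 = C0 * (1 + K + K\<^sup>2)"
  have C1: "C1 > 0" using C0(1) K(1) by (simp add: C1_def add_pos_pos)
  have J_abs: "\<bar>J x y\<bar> \<le> C1 * (1 + (norm x)\<^sup>2)" for x y
  proof -
    have "(norm (H *v x))\<^sup>2 \<le> K\<^sup>2 * (norm x)\<^sup>2"
      using power_mono[OF K(2) norm_ge_zero, of x 2] by (simp add: power_mult_distrib)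
    moreover have "0 \<le> K * (norm x)\<^sup>2" "0 \<le> K\<^sup>2" "0 \<le> (norm x)\<^sup>2"
      using K(1) by auto
    moreover have "(1 + K + K\<^sup>2) * (1 + (norm x)\<^sup>2)
        = 1 + K + K\<^sup>2 + (norm x)\<^sup>2 + K * (norm x)\<^sup>2 + K\<^sup>2 * (norm x)\<^sup>2"
      by (simp add: algebra_simps)
    ultimately have "1 + (norm (H *v x))\<^sup>2 \<le> (1 + K + K\<^sup>2) * (1 + (norm x)\<^sup>2)"
      using K(1) by linarith
    then have "C0 * (1 + (norm (H *v x))\<^sup>2) \<le> C1 * (1 + (norm x)\<^sup>2)"
      using C0(1) by (simp add: C1_def mult.assoc)
    then show ?thesis
      using C0(2)[of "H *v x" y] unfolding J_def by linarith
  qed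
  have J_ge: "- C1 * (1 + norm x) \<le> J x y" for x y
  proof -
    have "0 \<le> K\<^sup>2 * norm x" "0 \<le> K\<^sup>2" "0 \<le> norm x"
      by auto
    moreover have "(1 + K + K\<^sup>2) * (1 + norm x)
        = 1 + K + K\<^sup>2 + norm x + K * norm x + K\<^sup>2 * norm x"
      by (simp add: algebra_simps)
    ultimately have "1 + norm (H *v x) \<le> (1 + K + K\<^sup>2) * (1 + norm x)"
      using K(1) K(2)[of x] by linarith
    then have "C0 * (1 + norm (H *v x)) \<le> C1 * (1 + norm x)"
      using C0(1) by (simp add: C1_def mult.assoc)
    then show ?thesis
      using C0(3)[of "H *v x" y] unfolding J_def by simp
  qed
  have J_int: "integrable M (J x)" for x
    by (rule M.integrable_const_bound[where B = "C1 * (1 + (norm x)\<^sup>2)"]) (auto simp: J_abs)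
  have a_meas [measurable]: "a \<in> borel_measurable borel"
    unfolding a_def by measurable
  define m where "m = measure M (space M)"
  have m: "m \<ge> 0" by (simp add: m_def)
  \<comment> \<open>One constant for both functions: it dominates \<open>C1\<close>, needed for
    \<open>J\<close>, and \<open>C1 * m\<close>, needed for \<open>a\<close>, which integrates
    \<open>J\<close> against total mass \<open>m\<close>.\<close>
  define C where "C = C1 * (1 + m)"
  have C: "C > 0" "C1 \<le> C" "C1 * m \<le> C"
    using C1 m by (auto simp: C_def distrib_left intro!: add_pos_nonneg)
  have J_bounds: "\<bar>J x y\<bar> \<le> C * (1 + (norm x)\<^sup>2)" "- J x y \<le> C * (1 + norm x)" for x y
  proof -
    have "C1 * (1 + (norm x)\<^sup>2) \<le> C * (1 + (norm x)\<^sup>2)" "C1 * (1 + norm x) \<le> C * (1 + norm x)"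
      using C(2) by (auto intro!: mult_right_mono)
    then show "\<bar>J x y\<bar> \<le> C * (1 + (norm x)\<^sup>2)" "- J x y \<le> C * (1 + norm x)"
      using J_abs[of x y] J_ge[of x y] by auto
  qed
  have a_bounds: "\<bar>a x\<bar> \<le> C * (1 + (norm x)\<^sup>2)" "- a x \<le> C * (1 + norm x)" for x
  proof -
    have "\<bar>a x\<bar> \<le> (\<integral>y. \<bar>J x y\<bar> \<partial>M)"
      unfolding a_def by (rule integral_abs_bound)
    also have "\<dots> \<le> (\<integral>y. C1 * (1 + (norm x)\<^sup>2) \<partial>M)"
      by (intro integral_mono integrable_abs J_int J_abs) auto
    also have "\<dots> = C1 * m * (1 + (norm x)\<^sup>2)"
      by (simp add: m_def)
    also have "\<dots> \<le> C * (1 + (norm x)\<^sup>2)"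
      using C by (intro mult_right_mono) auto
    finally show "\<bar>a x\<bar> \<le> C * (1 + (norm x)\<^sup>2)" .
    have "- (C * (1 + norm x)) \<le> - (C1 * m * (1 + norm x))"
      using C(3) by (auto intro!: mult_right_mono)
    also have "\<dots> = (\<integral>y. - C1 * (1 + norm x) \<partial>M)"
      by (simp add: m_def)
    also have "\<dots> \<le> a x"
      unfolding a_def by (intro integral_mono J_int J_ge) auto
    finally show "- a x \<le> C * (1 + norm x)" by simp
  qed

  \<comment> \<open>A majorant with Gaussian decay\<close>
  define W where "W = (\<lambda>x. prior x * ((1 + (norm x)\<^sup>2) * exp (C * (1 + norm x))))"
  obtain c0 K0 where c0: "c0 > 0" "K0 > 0" "\<And>x. prior x \<le> K0 * exp (- c0 * (norm x)\<^sup>2)"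
    using gaussian_density_upper_bound[OF P, of mf] unfolding prior_def by blast
  obtain K1 where K1: "K1 > 0"
      "\<And>r. (1 + r\<^sup>2) * exp (C * (1 + r)) * exp (- c0 * r\<^sup>2) \<le> K1 * exp (- (c0 / 2) * r\<^sup>2)"
    using polynomial_exp_gaussian_bound[OF c0(1), of C] by blast
  have W_nn: "W x \<ge> 0" for x
    using prior_pos[of x] by (simp add: W_def)
  \<comment> \<open>This decay makes \<open>W\<close> bounded, as needed for the numerator, and
    integrable, as needed for the normalising constant and its derivative.\<close>
  have W_le: "W x \<le> K0 * K1 * exp (- (c0 / 2) * (norm x)\<^sup>2)" for x
  proof -
    have "W x \<le> K0 * exp (- c0 * (norm x)\<^sup>2) * ((1 + (norm x)\<^sup>2) * exp (C * (1 + norm x)))"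
      unfolding W_def by (intro mult_right_mono c0) auto
    also have "\<dots> = K0 * ((1 + (norm x)\<^sup>2) * exp (C * (1 + norm x)) * exp (- c0 * (norm x)\<^sup>2))"
      by (simp add: mult_ac)
    also have "\<dots> \<le> K0 * (K1 * exp (- (c0 / 2) * (norm x)\<^sup>2))"
      using c0(2) K1(2) by (intro mult_left_mono) auto
    finally show ?thesis by (simp add: mult.assoc)
  qed
  define B where "B = K0 * K1"
  have W_bounded: "W x \<le> B" for x
  proof -
    have "K0 * K1 * exp (- (c0 / 2) * (norm x)\<^sup>2) \<le> K0 * K1 * 1"
      using c0 K1 by (intro mult_left_mono) auto
    then show ?thesis using W_le[of x] by (simp add: B_def)
  qed
  have W_int: "integrable lborel W"
  proof (rule Bochner_Integration.integrable_bound)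
    show "integrable lborel (\<lambda>x::real^'x. K0 * K1 * exp (- (c0 / 2) * (norm x)\<^sup>2))"
      using c0 by (intro integrable_mult_right exp_neg_norm_square_integrable) auto
    show "W \<in> borel_measurable lborel"
      unfolding W_def by measurable
    show "AE x in lborel. norm (W x) \<le> norm (K0 * K1 * exp (- (c0 / 2) * (norm x)\<^sup>2))"
      using W_nn W_le c0 K1 by auto
  qed

  \<comment> \<open>The normalising constant and the candidate influence function\<close>
  define Z where "Z = (\<integral>x. prior x * exp (- a x) \<partial>lborel)"
  have weight_le: "prior x * exp (- a x) \<le> W x" for x
  proof -
    have "exp (- a x) \<le> 1 * exp (C * (1 + norm x))"
      using a_bounds(2)[of x] by simp
    also have "\<dots> \<le> (1 + (norm x)\<^sup>2) * exp (C * (1 + norm x))"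
      by (intro mult_right_mono) auto
    finally show ?thesis
      unfolding W_def using prior_pos[of x] by (intro mult_left_mono) auto
  qed
  have weight_int: "integrable lborel (\<lambda>x. prior x * exp (- a x))"
    by (rule Bochner_Integration.integrable_bound[OF W_int])
      (use weight_le W_nn prior_pos in \<open>auto simp: less_imp_le\<close>)
  have Z_pos: "Z > 0"
  proof -
    \<comment> \<open>A strictly positive integrand with zero integral would make the whole space a
      Lebesgue null set.\<close>
    have "Z \<noteq> 0"
    proof
      assume "Z = 0"
      then have "AE x in lborel. prior x * exp (- a x) = 0"
        using integral_nonneg_eq_0_iff_AE[OF weight_int] prior_pos
        by (auto simp: Z_def less_imp_le)
      then have "AE x in (lborel :: (real^'x) measure). False"
        using prior_pos by (auto simp: less_imp_neq[symmetric])
      then show False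
        by (simp add: AE_iff_null null_sets_def)
    qed
    moreover have "Z \<ge> 0"
      unfolding Z_def using prior_pos by (intro integral_nonneg_AE) (auto simp: less_imp_le)
    ultimately show ?thesis by simp
  qed
  define dZ where "dZ = (\<lambda>y0. \<integral>x. prior x * ((a x - J x y0) * exp (- a x)) \<partial>lborel)"
  \<comment> \<open>The quotient rule at \<epsilon> = 0, where the numerator is
    \<open>prior x * exp (- a x)\<close> and the denominator is \<open>Z\<close>.\<close>
  define PIF where "PIF = (\<lambda>x y0. (prior x * ((a x - J x y0) * exp (- a x)) * Z
      - prior x * exp (- a x) * dZ y0) / (Z * Z))"

  \<comment> \<open>The loss along the contamination and its integrable majorants\<close>
  have dsm: "DSM w (contamination q \<epsilon> y0) (lik x) = (1 - \<epsilon>) * a x + \<epsilon> * J x y0"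
    if "\<epsilon> \<in> {0..1}" for \<epsilon> x y0
  proof -
    have "DSM w (contamination q \<epsilon> y0) (lik x) = (\<integral>y. J x y \<partial>contamination q \<epsilon> y0)"
      unfolding DSM_def lik_def J_def
      by (subst DSM_integrand_gaussian[OF R dk w_def[THEN meta_eq_to_obj_eq]]) simp
    also have "\<dots> = (1 - \<epsilon>) * a x + \<epsilon> * J x y0"
      unfolding a_def M_def
      by (rule integral_contamination[OF that J_int[unfolded M_def]])
    finally show ?thesis .
  qed
  have slope_le: "prior x * \<bar>a x - J x y0\<bar> * exp (C * (1 + norm x)) \<le> 2 * C * W x" for x y0
  proof -
    have "\<bar>a x - J x y0\<bar> \<le> 2 * C * (1 + (norm x)\<^sup>2)"
      using a_bounds(1)[of x] J_bounds(1)[of x y0] by linarith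
    then have "prior x * \<bar>a x - J x y0\<bar> * exp (C * (1 + norm x))
        \<le> prior x * (2 * C * (1 + (norm x)\<^sup>2)) * exp (C * (1 + norm x))"
      using prior_pos[of x] by (intro mult_right_mono mult_left_mono) auto
    then show ?thesis by (simp only: W_def mult_ac)
  qed
  have slope_int: "integrable lborel (\<lambda>x. prior x * \<bar>a x - J x y0\<bar> * exp (C * (1 + norm x)))" for y0
    by (rule Bochner_Integration.integrable_bound[OF integrable_mult_right[OF W_int, of "2 * C"]])
      (use slope_le C W_nn prior_pos in \<open>auto simp: less_imp_le abs_mult\<close>)
  have base_int: "integrable lborel (\<lambda>x. prior x * exp (C * (1 + norm x)))"
  proof (rule Bochner_Integration.integrable_bound[OF W_int])
    have "prior x * (1 * exp (C * (1 + norm x))) \<le> W x" for x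
      unfolding W_def using prior_pos[of x] by (intro mult_left_mono mult_right_mono) auto
    then show "AE x in lborel. norm (prior x * exp (C * (1 + norm x))) \<le> norm (W x)"
      using W_nn prior_pos by (auto simp: less_imp_le abs_mult)
  qed measurable

  \<comment> \<open>Differentiating the posterior\<close>
  have deriv: "((\<lambda>\<epsilon>. DSM_posterior prior lik w (contamination q \<epsilon> y0) x)
      has_real_derivative PIF x y0) (at 0 within {0..1})" for x y0
  proof -
    have dN: "((\<lambda>\<epsilon>. prior x * exp (- ((1 - \<epsilon>) * a x + \<epsilon> * J x y0))) has_real_derivative
        prior x * ((a x - J x y0) * exp (- a x))) (at 0 within {0..1})"
      by (auto intro!: derivative_eq_intros)
    have dI: "((\<lambda>\<epsilon>. \<integral>x. prior x * exp (- ((1 - \<epsilon>) * a x + \<epsilon> * J x y0)) \<partial>lborel)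
        has_real_derivative dZ y0) (at 0 within {0..1})"
      unfolding dZ_def
      by (rule tilted_integral_has_derivative[where L = "\<lambda>x. C * (1 + norm x)"])
        (use prior_pos a_bounds(2) J_bounds(2) base_int slope_int in \<open>auto simp: less_imp_le\<close>)
    have "((\<lambda>\<epsilon>. prior x * exp (- ((1 - \<epsilon>) * a x + \<epsilon> * J x y0))
        / (\<integral>x. prior x * exp (- ((1 - \<epsilon>) * a x + \<epsilon> * J x y0)) \<partial>lborel))
        has_real_derivative PIF x y0) (at 0 within {0..1})"
      using DERIV_divide[OF dN dI] Z_pos by (simp add: PIF_def Z_def)
    then show ?thesis
      \<comment> \<open>The affine formula for the loss is available on the unit interval, which is
        the set along which the derivative is taken.\<close>
      by (rule has_field_derivative_transform_within[where d = 1])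
        (auto simp: DSM_posterior_def dsm)
  qed

  \<comment> \<open>Bounding the influence function uniformly in \<open>x\<close> and
    \<open>y0\<close>\<close>
  have slope_abs: "\<bar>prior x * ((a x - J x y0) * exp (- a x))\<bar> \<le> 2 * C * W x" for x y0
  proof -
    have "\<bar>prior x * ((a x - J x y0) * exp (- a x))\<bar> = prior x * \<bar>a x - J x y0\<bar> * exp (- a x)"
      using prior_pos[of x] by (simp add: abs_mult)
    also have "\<dots> \<le> prior x * \<bar>a x - J x y0\<bar> * exp (C * (1 + norm x))"
      using prior_pos[of x] a_bounds(2)[of x] by (intro mult_left_mono) auto
    finally show ?thesis using slope_le[of x y0] by linarith
  qed
  define D where "D = 2 * C * (\<integral>x. W x \<partial>lborel)"
  have dZ_le: "\<bar>dZ y0\<bar> \<le> D" for y0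
  proof -
    have int: "integrable lborel (\<lambda>x. prior x * ((a x - J x y0) * exp (- a x)))"
      by (rule Bochner_Integration.integrable_bound[OF integrable_mult_right[OF W_int, of "2 * C"]])
        (use slope_abs C W_nn in \<open>auto simp: abs_mult\<close>)
    have "\<bar>dZ y0\<bar> \<le> (\<integral>x. \<bar>prior x * ((a x - J x y0) * exp (- a x))\<bar> \<partial>lborel)"
      unfolding dZ_def by (rule integral_abs_bound)
    also have "\<dots> \<le> (\<integral>x. 2 * C * W x \<partial>lborel)"
      by (intro integral_mono integrable_abs int slope_abs integrable_mult_right W_int)
    finally show ?thesis by (simp add: D_def)
  qed
  have PIF_le: "PIF x y0 \<le> (2 * C * B * Z + B * D) / (Z * Z)" for x y0
  proof -
    have "prior x * ((a x - J x y0) * exp (- a x)) \<le> 2 * C * B"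
      using slope_abs[of x y0] mult_left_mono[OF W_bounded[of x], of "2 * C"] C(1) by linarith
    then have "prior x * ((a x - J x y0) * exp (- a x)) * Z \<le> 2 * C * B * Z"
      using Z_pos by (intro mult_right_mono) auto
    \<comment> \<open>The sign of \<open>dZ y0\<close> is unknown, so it is replaced by
      \<open>D\<close>, a bound on its absolute value that does not depend on
      \<open>y0\<close>.\<close>
    moreover have "prior x * exp (- a x) * (- dZ y0) \<le> prior x * exp (- a x) * D"
      using dZ_le[of y0] prior_pos[of x] by (intro mult_left_mono) auto
    moreover have "prior x * exp (- a x) * D \<le> B * D"
      using weight_le[of x] W_bounded[of x] dZ_le[of y0] by (intro mult_right_mono) auto
    ultimately show ?thesis
      unfolding PIF_def by (intro divide_right_mono) auto
  qed
  have "(SUP (x, y0) \<in> UNIV. ereal (PIF x y0)) \<le> ereal ((2 * C * B * Z + B * D) / (Z * Z))"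
    by (rule SUP_least) (auto simp: PIF_le)
  then have "(SUP (x, y0) \<in> UNIV. ereal (PIF x y0)) < \<infinity>"
    by (rule order_le_less_trans) simp
  with deriv show ?thesis
    unfolding q_def by blast
qed

end
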